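(* For any $n\ge1$, $k\ge1$ and $\lambda\vdash n$, $$\left(\prod_{i=1}^k(q_i;q_i)_n\right)s_\lambda\!\left[\frac{1}{(1-q_1)\cdots(1-q_k)}\right]=\sum_{P\in\mathcal{T}^k_\lambda}q^P.$$
   Context: $s_\lambda[1/((1-q_1)\cdots(1-q_k))]$ is $s_\lambda$ evaluated at all monomials $q_1^{a_1}\cdots q_k^{a_k}$, $a\in\mathbb{N}^k$. $(q;t)_r=(1-q)(1-qt)\cdots(1-qt^{r-1})$. $\epsilon$ is the identity of $S_n$; $\mathrm{SYT}(\lambda)$ the standard Young tableaux of shape $\lambda$; for such $T$, $\mathrm{des}(T)$ is the set of $i$ such that $i+1$ lies in a strictly lower row than $i$ (English notation). Definitions. $\mathbb{N}=\{0,1,\dots\}$; sequences in $\mathbb{N}^r$ compared lexicographically. For $R\subseteq\{1,\dots,n-1\}$ and distinct $a,b$, $a\sim_R b$ if all of $\min(a,b),\dots,\max(a,b)-1$ lie in $R$. For $S=(s^1,\dots,s^n)\in(\mathbb{N}^r)^n$ (if $r=0$ all $s^i$ empty and equal) and $\sigma\in S_n$, $\mathrm{Des}_{R,S}(\sigma)$ is the set of $i\in\{1,\dots,n-1\}$ with either $s^{\sigma_i}>s^{\sigma_{i+1}}$, or $s^{\sigma_i}=s^{\sigma_{i+1}}$ and either ($\sigma_{i+1}<\sigma_i$ and not $\sigma_{i+1}\sim_R\sigma_i$) or ($\sigma_{i+1}>\sigma_i$ and $\sigma_i\sim_R\sigma_{i+1}$). $Z_{R,\sigma}(S)\in(\mathbb{N}^{r+1})^n$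 prepends to each $s^j$ a first coordinate $z^j_1$ with $z^{\sigma_i}_1=\#\{j<i:j\in\mathrm{Des}_{R,S}(\sigma)\}$. For $T\in\mathrm{SYT}(\lambda)$ with $R=\mathrm{des}(T)$ and $\vec{\sigma}=(\sigma^1,\dots,\sigma^{k-1})\in S_n^{\times(k-1)}$, set $\sigma^k=\epsilon$, $Z^0=$ list of $n$ empty sequences, $Z^i=Z_{R,\sigma^i}(Z^{i-1})$; writing $Z^k=(z^1,\dots,z^n)\in(\mathbb{N}^k)^n$, $P_{T,\vec{\sigma}}$ is the tableau obtained from $T$ by replacing each entry $i$ by $z^i$. $\mathcal{T}^k_\lambda=\{P_{T,\vec\sigma}: T\in\mathrm{SYT}(\lambda),\ \vec\sigma\in S_n^{\times(k-1)}\}$ (a set). For a tableau $P$ with entries $s^1,\dots,s^n\in\mathbb{N}^k$, $q^P=\prod_{i=1}^k q_i^{\sum_j s^j_{k-i+1}}$. *)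

theory Defs
  imports "HOL-Computational_Algebra.Polynomial" "HOL-Combinatorics.Permutations"
begin

definition is_partition :: "nat list \<Rightarrow> nat \<Rightarrow> bool" where
  "is_partition lam n \<longleftrightarrow> sorted_wrt (\<ge>) lam \<and> 0 \<notin> set lam \<and> sum_list lam = n"

text \<open>Cells of the Young diagram (English notation): row i (0-based, top row 0), column j.\<close>
definition cells :: "nat list \<Rightarrow> (nat \<times> nat) set" where
  "cells lam = {(i, j). i < length lam \<and> j < lam ! i}"

definition SYT :: "nat list \<Rightarrow> (nat \<times> nat \<Rightarrow> nat) set" where
  "SYT lam = {T. bij_betw T (cells lam) {1..sum_list lam}
      \<and> (\<forall>c. c \<notin> cells lam \<longrightarrow> T c = 0)
      \<and> (\<forall>i j. (i, j + 1) \<in> cells lam \<longrightarrow> T (i, j) < T (i, j + 1))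
      \<and> (\<forall>i j. (i + 1, j) \<in> cells lam \<longrightarrow> T (i, j) < T (i + 1, j))}"

definition row_of :: "nat list \<Rightarrow> (nat \<times> nat \<Rightarrow> nat) \<Rightarrow> nat \<Rightarrow> nat" where
  "row_of lam T m = fst (the_inv_into (cells lam) T m)"

definition des :: "nat list \<Rightarrow> (nat \<times> nat \<Rightarrow> nat) \<Rightarrow> nat set" where
  "des lam T = {i \<in> {1..<sum_list lam}. row_of lam T i < row_of lam T (i + 1)}"

definition lex_less :: "nat list \<Rightarrow> nat list \<Rightarrow> bool" where
  "lex_less xs ys \<longleftrightarrow> (xs, ys) \<in> lexord {(a, b). a < b}"

definition lex_le :: "nat list \<Rightarrow> nat list \<Rightarrow> bool" where
  "lex_le xs ys \<longleftrightarrow> xs = ys \<or> lex_less xs ys"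

definition sim :: "nat set \<Rightarrow> nat \<Rightarrow> nat \<Rightarrow> bool" where
  "sim R a b \<longleftrightarrow> a \<noteq> b \<and> {min a b..<max a b} \<subseteq> R"

text \<open>S is the list (s^1,...,s^n), given as a function on {1..n}.\<close>
definition DesRS :: "nat \<Rightarrow> nat set \<Rightarrow> (nat \<Rightarrow> nat list) \<Rightarrow> (nat \<Rightarrow> nat) \<Rightarrow> nat set" where
  "DesRS n R S \<sigma> = {i \<in> {1..<n}.
      lex_less (S (\<sigma> (i + 1))) (S (\<sigma> i))
      \<or> (S (\<sigma> i) = S (\<sigma> (i + 1)) \<and>
          ((\<sigma> (i + 1) < \<sigma> i \<and> \<not> sim R (\<sigma> (i + 1)) (\<sigma> i))
           \<or> (\<sigma> (i + 1) > \<sigma> i \<and> sim R (\<sigma> i) (\<sigma> (i + 1)))))}"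

definition Zstep :: "nat \<Rightarrow> nat set \<Rightarrow> (nat \<Rightarrow> nat) \<Rightarrow> (nat \<Rightarrow> nat list) \<Rightarrow> (nat \<Rightarrow> nat list)" where
  "Zstep n R \<sigma> S = (\<lambda>j. card {m \<in> DesRS n R S \<sigma>. m < inv \<sigma> j} # S j)"

text \<open>Z^k for sigma-vector (sigma^1,...,sigma^(k-1)) and sigma^k = identity.\<close>
definition Zfinal :: "nat \<Rightarrow> nat set \<Rightarrow> (nat \<Rightarrow> nat) list \<Rightarrow> (nat \<Rightarrow> nat list)" where
  "Zfinal n R \<sigma>s = foldl (\<lambda>S \<sigma>. Zstep n R \<sigma> S) (\<lambda>_. []) (\<sigma>s @ [id])"

definition Ptab :: "nat list \<Rightarrow> (nat \<times> nat \<Rightarrow> nat) \<Rightarrow> (nat \<Rightarrow> nat) list \<Rightarrow> (nat \<times> nat \<Rightarrow> nat list)" where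
  "Ptab lam T \<sigma>s = (\<lambda>c. if c \<in> cells lam
      then Zfinal (sum_list lam) (des lam T) \<sigma>s (T c) else [])"

definition Tk :: "nat \<Rightarrow> nat list \<Rightarrow> (nat \<times> nat \<Rightarrow> nat list) set" where
  "Tk k lam = {Ptab lam T \<sigma>s | T \<sigma>s. T \<in> SYT lam \<and> length \<sigma>s = k - 1
      \<and> (\<forall>\<sigma> \<in> set \<sigma>s. \<sigma> permutes {1..sum_list lam})}"

text \<open>Exponent vector of q^P: entry i (0-based) is the exponent of q_(i+1),
  i.e. the sum of the (k-i)-th (1-based) coordinates of the entries.\<close>
definition qexp :: "nat \<Rightarrow> nat list \<Rightarrow> (nat \<times> nat \<Rightarrow> nat list) \<Rightarrow> nat list" where
  "qexp k lam P = map (\<lambda>i. \<Sum>c\<in>cells lam. P c ! (k - 1 - i)) [0..<k]"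

definition SSYT_vec :: "nat \<Rightarrow> nat list \<Rightarrow> (nat \<times> nat \<Rightarrow> nat list) set" where
  "SSYT_vec k lam = {S. (\<forall>c \<in> cells lam. length (S c) = k)
      \<and> (\<forall>c. c \<notin> cells lam \<longrightarrow> S c = [])
      \<and> (\<forall>i j. (i, j + 1) \<in> cells lam \<longrightarrow> lex_le (S (i, j)) (S (i, j + 1)))
      \<and> (\<forall>i j. (i + 1, j) \<in> cells lam \<longrightarrow> lex_less (S (i, j)) (S (i + 1, j)))}"

text \<open>Coefficient of q^e in s_lam evaluated at all monomials q^a, a in N^k
  (combinatorial definition of the Schur function via SSYT, alphabet = monomials).\<close>
definition schur_coeff :: "nat \<Rightarrow> nat list \<Rightarrow> nat list \<Rightarrow> nat" where
  "schur_coeff k lam e = card {S \<in> SSYT_vec k lam.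
      \<forall>l < k. (\<Sum>c\<in>cells lam. S c ! l) = e ! l}"

definition qpoch :: "nat \<Rightarrow> int poly" where
  "qpoch n = (\<Prod>j = 1..n. 1 - monom 1 j)"

definition le_vecs :: "nat list \<Rightarrow> nat list set" where
  "le_vecs e = {d. length d = length e \<and> (\<forall>i < length e. d ! i \<le> e ! i)}"

text \<open>Coefficient of q^e (e of length k) in (prod_i (q_i;q_i)_n) * s_lam[1/((1-q_1)...(1-q_k))].\<close>
definition lhs_coeff :: "nat \<Rightarrow> nat \<Rightarrow> nat list \<Rightarrow> nat list \<Rightarrow> int" where
  "lhs_coeff n k lam e = (\<Sum>d \<in> le_vecs e.
      (\<Prod>i<k. coeff (qpoch n) (d ! i)) * int (schur_coeff k lam (map2 (-) e d)))"

end

theory Submission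
  imports Defs "HOL-Library.List_Lexorder" "HOL-Library.Product_Lexorder"
    "HOL-Computational_Algebra.Polynomial_FPS"
begin

text \<open>
  Fix \<open>R\<close>. A list \<open>S\<close> of \<open>n\<close> sequences induces a total order on \<open>{1..n}\<close>, and prepending a layer \<open>w\<close> of
  coordinates gives a list whose order is \<open>\<sigma>\<close> iff \<open>w\<close> increases weakly along \<open>\<sigma>\<close>, and strictly at
  \<open>DesRS n R S \<sigma>\<close>. The least such layer is the one added by \<open>Zstep\<close>, and the others differ from it by a
  partition with at most \<open>n\<close> parts, which contributes the factor \<open>1 / (q;q)\<^sub>n\<close>. As the descents depend
  on \<open>S\<close> only through its order, induction on the number of layers shows that multiplication by
  \<open>\<Prod>i. (q\<^sub>i;q\<^sub>i)\<^sub>n\<close> turns the generating function of all lists with a given order into that of the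
  lists produced by words of permutations.

  For \<open>R = des T\<close>, the lists whose order is the identity are the weakly increasing sequences that
  increase strictly at the descents of \<open>T\<close>. By standardization, summing over \<open>T\<close> gives all
  semistandard tableaux. The exponent vector of \<open>q\<^sup>P\<close> reads the coordinates in reverse, which is
  harmless because Schur functions are symmetric; this is proved with the Bender--Knuth involutions.
\<close>

section \<open>The order induced by a list of sequences\<close>

text \<open>Numbers the classes of \<open>sim R\<close> from left to right: for positive
  \<open>a\<close>, passing from \<open>a\<close> to \<open>a + 1\<close> raises the number exactly
  when \<open>a\<close> lies outside \<open>R\<close>.\<close>

definition block :: "nat set \<Rightarrow> nat \<Rightarrow> nat" where
  "block R a = card ({1..<a} - R)"

text \<open>Comparing keys compares sequences, breaking ties from left to right between the classes of
  \<open>sim R\<close> and from right to left within a class. Hence \<open>DesRS\<close> is the ordinary descent set of the ranks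
  of the keys read along \<open>\<sigma>\<close>.\<close>
definition key :: "nat set \<Rightarrow> (nat \<Rightarrow> nat list) \<Rightarrow> nat \<Rightarrow> nat list \<times> nat \<times> int" where
  "key R S a = (S a, block R a, - int a)"

text \<open>Fixing everything outside \<open>{1..n}\<close> makes the rank of an injective
  \<open>f\<close> satisfy \<open>permutes\<close>, so that an induced order can be compared with
  \<open>inv \<sigma>\<close>.\<close>

definition rank_on :: "nat \<Rightarrow> (nat \<Rightarrow> 'a::linorder) \<Rightarrow> nat \<Rightarrow> nat" where
  "rank_on n f a = (if a \<in> {1..n} then card {b \<in> {1..n}. f b \<le> f a} else a)"

definition inv_descents :: "nat \<Rightarrow> (nat \<Rightarrow> nat) \<Rightarrow> (nat \<Rightarrow> nat) \<Rightarrow> nat set" where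
  "inv_descents n \<rho> \<sigma> = {i \<in> {1..<n}. \<rho> (\<sigma> (i + 1)) < \<rho> (\<sigma> i)}"

lemma block_split:
  assumes "1 \<le> a" "a \<le> b"
  shows "block R b = block R a + card ({a..<b} - R)"
proof -
  have "{1..<b} - R = ({1..<a} - R) \<union> ({a..<b} - R)" using assms by auto
  then show ?thesis unfolding block_def
    by (simp add: card_Un_disjoint disjoint_iff)
qed

lemma sim_iff_block:
  assumes "1 \<le> a" "a < b"
  shows "sim R a b \<longleftrightarrow> block R a = block R b" "sim R b a \<longleftrightarrow> block R a = block R b"
  using block_split[of a b R] assms by (auto simp: sim_def)

lemma inj_on_key: "inj_on (key R S) A"
  by (auto simp: inj_on_def key_def)

lemma block_mono: "1 \<le> a \<Longrightarrow> a \<le> b \<Longrightarrow> block R a \<le> block R b"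
  using block_split[of a b R] by simp

lemma key_less_iff:
  assumes "1 \<le> a" "1 \<le> b"
  shows "key R S b < key R S a \<longleftrightarrow> lex_less (S b) (S a) \<or>
    S a = S b \<and> (b < a \<and> \<not> sim R b a \<or> a < b \<and> sim R a b)"
proof -
  have "lex_less (S b) (S a) \<longleftrightarrow> S b < S a" by (simp add: lex_less_def list_less_def)
  moreover have "(block R b, - int b) < (block R a, - int a) \<longleftrightarrow>
    b < a \<and> \<not> sim R b a \<or> a < b \<and> sim R a b"
  proof (cases a b rule: linorder_cases)
    case less
    then show ?thesis using block_mono[of a b R] sim_iff_block[of a b R] assms by auto
  next
    case greater
    then show ?thesis using block_mono[of b a R] sim_iff_block[of b a R] assms by auto
  qed simp
  ultimately show ?thesis by (auto simp: key_def)
qed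

lemma card_le_less_iff:
  fixes f :: "'b \<Rightarrow> 'a::linorder"
  assumes "finite A" "a \<in> A" "b \<in> A"
  shows "card {x \<in> A. f x \<le> f a} < card {x \<in> A. f x \<le> f b} \<longleftrightarrow> f a < f b"
proof (cases "f a < f b")
  case True
  have "{x \<in> A. f x \<le> f a} \<subset> {x \<in> A. f x \<le> f b}"
  proof (rule psubsetI)
    have "b \<in> {x \<in> A. f x \<le> f b} - {x \<in> A. f x \<le> f a}" using True assms by simp
    then show "{x \<in> A. f x \<le> f a} \<noteq> {x \<in> A. f x \<le> f b}" by blast
  qed (use True in auto)
  then show ?thesis using True assms(1) by (simp add: psubset_card_mono)
next
  case False
  then have "{x \<in> A. f x \<le> f b} \<subseteq> {x \<in> A. f x \<le> f a}" by auto
  then have "card {x \<in> A. f x \<le> f b} \<le> card {x \<in> A. f x \<le> f a}"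
    using assms(1) by (intro card_mono) auto
  then show ?thesis using False by simp
qed

text \<open>Standardization in general form: it turns keys into permutations of
  \<open>{1..n}\<close> here, and later semistandard tableaux into standard ones.\<close>

lemma bij_betw_card_le:
  fixes f :: "'b \<Rightarrow> 'a::linorder"
  assumes A: "finite A" and f: "inj_on f A"
  shows "bij_betw (\<lambda>a. card {x \<in> A. f x \<le> f a}) A {1..card A}"
proof -
  let ?r = "\<lambda>a. card {x \<in> A. f x \<le> f a}"
  have inj: "inj_on ?r A"
  proof (rule inj_onI)
    fix a b assume ab: "a \<in> A" "b \<in> A" "?r a = ?r b"
    then have "f a = f b"
      using card_le_less_iff[OF A, of a b f] card_le_less_iff[OF A, of b a f] by auto
    then show "a = b" using inj_onD[OF f] ab by blast
  qed
  have "?r ` A \<subseteq> {1..card A}"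
  proof (rule image_subsetI)
    fix a assume a: "a \<in> A"
    then have "card {x \<in> A. f x \<le> f a} \<noteq> 0" using A by auto
    moreover have "card {x \<in> A. f x \<le> f a} \<le> card A" using A by (intro card_mono) auto
    ultimately show "?r a \<in> {1..card A}" by simp
  qed
  moreover have "card (?r ` A) = card {1..card A}" using card_image[OF inj] by simp
  ultimately have "?r ` A = {1..card A}" by (intro card_subset_eq) auto
  then show ?thesis using inj by (simp add: bij_betw_def)
qed

lemma rank_on_less_iff:
  assumes "a \<in> {1..n}" "b \<in> {1..n}"
  shows "rank_on n f a < rank_on n f b \<longleftrightarrow> f a < f b"
  using card_le_less_iff[OF _ assms, of f] assms by (simp add: rank_on_def)

lemma rank_on_permutes:
  assumes "inj_on f {1..n}"
  shows "rank_on n f permutes {1..n}"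
proof (rule bij_imp_permutes)
  have "bij_betw (\<lambda>a. card {x \<in> {1..n}. f x \<le> f a}) {1..n} {1..n}"
    using bij_betw_card_le[OF _ assms] by simp
  then show "bij_betw (rank_on n f) {1..n} {1..n}"
    by (rule bij_betw_cong[THEN iffD1, rotated]) (simp only: rank_on_def if_True)
qed (auto simp: rank_on_def)

lemma rank_on_cong:
  assumes "\<And>a b. a \<in> {1..n} \<Longrightarrow> b \<in> {1..n} \<Longrightarrow> f a \<le> f b \<longleftrightarrow> g a \<le> g b"
  shows "rank_on n f = rank_on n g"
  unfolding rank_on_def by (intro ext if_cong refl arg_cong[where f = card] Collect_cong) (use assms in auto)

text \<open>If \<open>f\<close> increases strictly along \<open>\<sigma>\<close>, then
  \<open>\<sigma> i\<close> is the \<open>i\<close>-th smallest element and has rank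
  \<open>i\<close>. An induced order is thus tested on consecutive places only.\<close>

lemma rank_on_eq_inv_iff:
  fixes f :: "nat \<Rightarrow> 'a::linorder"
  assumes \<sigma>: "\<sigma> permutes {1..n}"
  shows "rank_on n f = inv \<sigma> \<and> inj_on f {1..n} \<longleftrightarrow> (\<forall>i\<in>{1..<n}. f (\<sigma> i) < f (\<sigma> (i + 1)))"
proof safe
  fix i assume r: "rank_on n f = inv \<sigma>" and i: "i \<in> {1..<n}"
  have "\<sigma> i \<in> {1..n}" "\<sigma> (i + 1) \<in> {1..n}" using i permutes_in_image[OF \<sigma>] by auto
  then show "f (\<sigma> i) < f (\<sigma> (i + 1))"
    using rank_on_less_iff[of "\<sigma> i" n "\<sigma> (i + 1)" f] r permutes_inverses(2)[OF \<sigma>] by simp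
next
  assume inc: "\<forall>i\<in>{1..<n}. f (\<sigma> i) < f (\<sigma> (i + 1))"
  have lt: "f (\<sigma> i) < f (\<sigma> j)" if "i < j" "1 \<le> i" "j \<le> n" for i j
    using that
  proof (induction j)
    case (Suc j)
    show ?case
    proof (cases "i = j")
      case False
      then have "f (\<sigma> i) < f (\<sigma> j)" using Suc by simp
      also have "\<dots> < f (\<sigma> (Suc j))" using inc Suc.prems by simp
      finally show ?thesis .
    qed (use inc Suc.prems in simp)
  qed simp
  have le: "f (\<sigma> i) \<le> f (\<sigma> j) \<longleftrightarrow> i \<le> j" if "i \<in> {1..n}" "j \<in> {1..n}" for i j
    using lt[of i j] lt[of j i] that by (cases i j rule: linorder_cases) auto
  show "inj_on f {1..n}"
  proof (rule inj_onI)
    fix a b assume ab: "a \<in> {1..n}" "b \<in> {1..n}" "f a = f b"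
    have "inv \<sigma> a \<in> {1..n}" "inv \<sigma> b \<in> {1..n}" using ab permutes_in_image[OF permutes_inv[OF \<sigma>]] by auto
    then have "inv \<sigma> a = inv \<sigma> b"
      using ab le[of "inv \<sigma> a" "inv \<sigma> b"] le[of "inv \<sigma> b" "inv \<sigma> a"] permutes_inverses(1)[OF \<sigma>] by auto
    then show "a = b" using permutes_inverses(1)[OF \<sigma>] by metis
  qed
  show "rank_on n f = inv \<sigma>"
  proof
    fix a show "rank_on n f a = inv \<sigma> a"
    proof (cases "a \<in> {1..n}")
      case True
      define i where "i = inv \<sigma> a"
      have i: "i \<in> {1..n}" "\<sigma> i = a"
        using True permutes_in_image[OF permutes_inv[OF \<sigma>]] permutes_inverses(1)[OF \<sigma>] by (auto simp: i_def)
      have "{b \<in> {1..n}. f b \<le> f a} = \<sigma> ` {b \<in> {1..n}. f (\<sigma> b) \<le> f a}"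
        by (subst permutes_image[OF \<sigma>, symmetric]) blast
      also have "{b \<in> {1..n}. f (\<sigma> b) \<le> f a} = {b \<in> {1..n}. b \<le> i}"
        using i le by blast
      also have "\<dots> = {1..i}" using i by auto
      also have "card (\<sigma> ` {1..i}) = i"
        using permutes_inj[OF \<sigma>] by (simp add: card_image inj_on_subset)
      finally show ?thesis using True by (simp add: rank_on_def i_def)
    next
      case False
      then show ?thesis using permutes_inv[OF \<sigma>] by (auto simp: rank_on_def permutes_not_in)
    qed
  qed
qed

text \<open>By \<open>key_less_iff\<close> the clauses of \<open>DesRS\<close> amount to a single
  comparison of keys. Hence descents depend on \<open>S\<close> only through its rank, which lets
  the later sums be grouped by rank.\<close>

lemma DesRS_eq_inv_descents:
  assumes \<sigma>: "\<sigma> permutes {1..n}"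
  shows "DesRS n R S \<sigma> = inv_descents n (rank_on n (key R S)) \<sigma>"
proof -
  have "(i \<in> DesRS n R S \<sigma>) = (i \<in> inv_descents n (rank_on n (key R S)) \<sigma>)" for i
  proof (cases "i \<in> {1..<n}")
    case True
    have "\<sigma> i \<in> {1..n}" "\<sigma> (i + 1) \<in> {1..n}" using True permutes_in_image[OF \<sigma>] by auto
    then show ?thesis
      using True rank_on_less_iff[of "\<sigma> (i + 1)" n "\<sigma> i" "key R S"]
        key_less_iff[of "\<sigma> i" "\<sigma> (i + 1)" R S]
      by (auto simp: DesRS_def inv_descents_def)
  qed (auto simp: DesRS_def inv_descents_def)
  then show ?thesis by blast
qed

text \<open>The new key compares \<open>w\<close> first and falls back on the old key. Between
  consecutive places it increases iff \<open>w\<close> does not drop and, where the old key drops,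
  that is, at a descent, rises strictly.\<close>

lemma rank_key_Cons_iff:
  assumes \<sigma>: "\<sigma> permutes {1..n}"
  shows "rank_on n (key R (\<lambda>j. w j # S j)) = inv \<sigma> \<longleftrightarrow>
    (\<forall>i\<in>{1..<n}. w (\<sigma> i) + of_bool (i \<in> DesRS n R S \<sigma>) \<le> w (\<sigma> (i + 1)))"
proof -
  have "key R (\<lambda>j. w j # S j) (\<sigma> i) < key R (\<lambda>j. w j # S j) (\<sigma> (i + 1)) \<longleftrightarrow>
    w (\<sigma> i) + of_bool (i \<in> DesRS n R S \<sigma>) \<le> w (\<sigma> (i + 1))" if i: "i \<in> {1..<n}" for i
  proof -
    have in1: "\<sigma> i \<in> {1..n}" "\<sigma> (i + 1) \<in> {1..n}" using i permutes_in_image[OF \<sigma>] by auto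
    \<comment> \<open>Different positions never share a key, so the absence of a descent means a
      strict ascent.\<close>
    have "key R S (\<sigma> i) \<noteq> key R S (\<sigma> (i + 1))"
      using permutes_inj[OF \<sigma>, THEN injD, of i "i + 1"] by (auto simp: key_def)
    then have "\<not> key R S (\<sigma> (i + 1)) < key R S (\<sigma> i) \<longleftrightarrow> key R S (\<sigma> i) < key R S (\<sigma> (i + 1))"
      by (metis less_asym neqE)
    moreover have "i \<in> DesRS n R S \<sigma> \<longleftrightarrow> key R S (\<sigma> (i + 1)) < key R S (\<sigma> i)"
      unfolding DesRS_eq_inv_descents[OF \<sigma>] inv_descents_def using rank_on_less_iff[OF in1(2,1)] i by blast
    ultimately have "i \<notin> DesRS n R S \<sigma> \<longleftrightarrow> key R S (\<sigma> i) < key R S (\<sigma> (i + 1))" by blast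
    moreover have "key R (\<lambda>j. w j # S j) a < key R (\<lambda>j. w j # S j) b \<longleftrightarrow>
      w a < w b \<or> w a = w b \<and> key R S a < key R S b" for a b
      by (auto simp: key_def)
    ultimately show ?thesis by (cases "i \<in> DesRS n R S \<sigma>") (simp_all add: Suc_le_eq, arith)
  qed
  then show ?thesis using rank_on_eq_inv_iff[OF \<sigma>, of "key R (\<lambda>j. w j # S j)"] by (simp add: inj_on_key)
qed

lemma card_below_Suc: "finite D \<Longrightarrow> card {m \<in> D. m < Suc i} = card {m \<in> D. m < i} + of_bool (i \<in> D)"
proof -
  assume "finite D"
  moreover have "{m \<in> D. m < Suc i} = {m \<in> D. m < i} \<union> (if i \<in> D then {i} else {})"
    by (auto simp: less_Suc_eq)
  ultimately show ?thesis by simp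
qed

text \<open>The new layer counts the descents passed along \<open>\<sigma>\<close>, so it rises by
  exactly one at each of them: the inequalities of \<open>rank_key_Cons_iff\<close> hold with
  equality.\<close>

lemma rank_key_Zstep:
  assumes \<sigma>: "\<sigma> permutes {1..n}"
  shows "rank_on n (key R (Zstep n R \<sigma> S)) = inv \<sigma>"
  unfolding Zstep_def rank_key_Cons_iff[OF \<sigma>]
proof
  fix i assume i: "i \<in> {1..<n}"
  let ?D = "DesRS n R S \<sigma>"
  have "card {m \<in> ?D. m < i + 1} = card {m \<in> ?D. m < i} + of_bool (i \<in> ?D)"
    using card_below_Suc[of ?D i] by (simp add: DesRS_def)
  then show "card {m \<in> ?D. m < inv \<sigma> (\<sigma> i)} + of_bool (i \<in> ?D) \<le> card {m \<in> ?D. m < inv \<sigma> (\<sigma> (i + 1))}"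
    by (simp add: permutes_inverses(2)[OF \<sigma>])
qed

section \<open>Sequences increasing along a permutation\<close>

text \<open>These lists are the partitions of \<open>m\<close> with at most \<open>n\<close> parts,
  padded with zeros.\<close>

definition sorted_count :: "nat \<Rightarrow> nat \<Rightarrow> nat" where
  "sorted_count n m = card {xs :: nat list. sorted xs \<and> length xs = n \<and> sum_list xs = m}"

lemma finite_lists_sum: "finite {xs :: nat list. length xs = n \<and> sum_list xs = m}"
proof (rule finite_subset)
  show "{xs. length xs = n \<and> sum_list xs = m} \<subseteq> {xs. set xs \<subseteq> {..m} \<and> length xs = n}"
    by (auto intro: member_le_sum_list)
  show "finite {xs. set xs \<subseteq> {..m} \<and> length xs = n}"
    by (rule finite_lists_length_eq) simp
qed

lemma finite_sorted_lists: "finite {xs :: nat list. sorted xs \<and> length xs = n \<and> sum_list xs = m}"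
  by (rule finite_subset[OF _ finite_lists_sum[of n m]]) auto

lemma sorted_count_0: "sorted_count 0 m = of_bool (m = 0)"
proof -
  have "{xs :: nat list. sorted xs \<and> length xs = 0 \<and> sum_list xs = m} = (if m = 0 then {[]} else {})" by auto
  then show ?thesis by (simp add: sorted_count_def)
qed

lemma sum_list_map_Suc: "sum_list (map Suc xs) = sum_list xs + length xs"
  by (induction xs) auto

text \<open>Split according to whether the smallest entry is zero.\<close>
lemma sorted_count_Suc:
  "sorted_count (Suc n) m = sorted_count n m + (if Suc n \<le> m then sorted_count (Suc n) (m - Suc n) else 0)"
proof -
  let ?L = "\<lambda>n m. {xs :: nat list. sorted xs \<and> length xs = n \<and> sum_list xs = m}"
  define B where "B = (if Suc n \<le> m then map Suc ` ?L (Suc n) (m - Suc n) else {})"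
  have eq: "?L (Suc n) m = Cons 0 ` ?L n m \<union> B"
  proof (intro equalityI subsetI)
    fix xs assume xs: "xs \<in> ?L (Suc n) m"
    then obtain y ys where xy: "xs = y # ys" by (cases xs) auto
    show "xs \<in> Cons 0 ` ?L n m \<union> B"
    proof (cases "y = 0")
      case True
      then show ?thesis using xs xy by auto
    next
      case False
      then have pos: "\<forall>x\<in>set xs. 0 < x" using xs xy by fastforce
      define zs where "zs = map (\<lambda>x. x - 1) xs"
      have "map Suc zs = xs" unfolding zs_def using pos by (simp add: map_idI)
      moreover have "sorted zs" using xs unfolding zs_def by (auto simp: sorted_iff_nth_mono intro: diff_le_mono)
      moreover have "length zs = Suc n" using xs by (simp add: zs_def)
      moreover have "sum_list zs + Suc n = m" using sum_list_map_Suc[of zs] calculation xs by simp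
      ultimately have "Suc n \<le> m" "zs \<in> ?L (Suc n) (m - Suc n)" by auto
      then show ?thesis using \<open>map Suc zs = xs\<close> by (auto simp: B_def image_iff)
    qed
  next
    fix xs assume "xs \<in> Cons 0 ` ?L n m \<union> B"
    then show "xs \<in> ?L (Suc n) m"
      by (auto simp: B_def sum_list_map_Suc sorted_map split: if_splits)
  qed
  have "card (?L (Suc n) m) = card (Cons 0 ` ?L n m) + card B"
    unfolding eq
  proof (rule card_Un_disjoint)
    show "finite (Cons 0 ` ?L n m)" using finite_sorted_lists by blast
    show "finite B" unfolding B_def using finite_sorted_lists[of "Suc n" "m - Suc n"] by simp
    show "Cons 0 ` ?L n m \<inter> B = {}" by (auto simp: B_def split: if_splits)
  qed
  also have "card (Cons 0 ` ?L n m) = sorted_count n m" by (simp add: card_image sorted_count_def)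
  also have "card B = (if Suc n \<le> m then sorted_count (Suc n) (m - Suc n) else 0)"
    by (simp add: B_def sorted_count_def card_image inj_on_def inj_map_eq_map)
  finally show ?thesis by (simp add: sorted_count_def)
qed

text \<open>Euler's generating function for these partitions. By \<open>sorted_count_Suc\<close> the
  factor \<open>1 - fps_X ^ Suc n\<close> turns the series for \<open>Suc n\<close> into that for
  \<open>n\<close>, so the factors of \<open>qpoch\<close> cancel one after another.\<close>

lemma qpoch_times_sorted_count:
  "fps_of_poly (qpoch n) * Abs_fps (\<lambda>m. int (sorted_count n m)) = 1"
proof (induction n)
  case 0
  then show ?case by (simp add: qpoch_def sorted_count_0 fps_eq_iff)
next
  case (Suc n)
  let ?P = "\<lambda>n. Abs_fps (\<lambda>m. int (sorted_count n m))"
  have "qpoch (Suc n) = qpoch n * (1 - monom 1 (Suc n))"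
    by (simp add: qpoch_def)
  moreover have "(1 - fps_X ^ Suc n) * ?P (Suc n) = ?P n"
  proof (rule fps_ext)
    fix m
    have "fps_nth (fps_X ^ Suc n * ?P (Suc n)) m = (if m < Suc n then 0 else int (sorted_count (Suc n) (m - Suc n)))"
      by (subst fps_X_power_mult_nth) simp
    then show "fps_nth ((1 - fps_X ^ Suc n) * ?P (Suc n)) m = fps_nth (?P n) m"
      using sorted_count_Suc[of n m] by (simp add: left_diff_distrib del: power_Suc)
  qed
  ultimately show ?case
    using Suc.IH by (simp add: fps_of_poly_mult fps_of_poly_diff fps_of_poly_monom' mult.assoc del: power_Suc)
qed

lemma qpoch_convolution:
  "(\<Sum>d\<le>m. coeff (qpoch n) d * int (sorted_count n (m - d))) = of_bool (m = 0)"
proof -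
  have "fps_nth (fps_of_poly (qpoch n) * Abs_fps (\<lambda>m. int (sorted_count n m))) m = of_bool (m = 0)"
    unfolding qpoch_times_sorted_count by simp
  then show ?thesis by (simp add: fps_mult_nth atMost_atLeast0)
qed

text \<open>The functions are extended by zero outside \<open>{1..n}\<close> to make them determined by their values there.\<close>
definition chains :: "nat \<Rightarrow> nat set \<Rightarrow> (nat \<Rightarrow> nat) \<Rightarrow> nat \<Rightarrow> (nat \<Rightarrow> nat) set" where
  "chains n D \<sigma> x = {w. (\<forall>j. j \<notin> {1..n} \<longrightarrow> w j = 0) \<and> (\<Sum>j\<in>{1..n}. w j) = x \<and>
    (\<forall>i\<in>{1..<n}. w (\<sigma> i) + of_bool (i \<in> D) \<le> w (\<sigma> (i + 1)))}"

text \<open>Subtracting from each value along \<open>\<sigma>\<close> the number of earlier elements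
  of \<open>D\<close> leaves an arbitrary weakly increasing list. \<open>M\<close> is the sum of the
  least chain, which is the layer added by \<open>Zstep\<close> when \<open>D\<close> is the descent
  set.\<close>

lemma card_chains:
  assumes \<sigma>: "\<sigma> permutes {1..n}" and D: "D \<subseteq> {1..<n}"
  defines "M \<equiv> \<Sum>i\<in>{1..n}. card {m \<in> D. m < i}"
  shows "card (chains n D \<sigma> x) = (if M \<le> x then sorted_count n (x - M) else 0)"
proof -
  define c where "c i = card {m \<in> D. m < i}" for i
  have c_Suc: "c (Suc i) = c i + of_bool (i \<in> D)" for i
    unfolding c_def by (rule card_below_Suc) (use D finite_subset in blast)
  \<comment> \<open>Lists count from 0 and positions from 1, hence \<open>Suc i\<close>. The
    subtraction is truncated; \<open>ge\<close> below shows that nothing is lost on chains.\<close>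
  define F where "F w = map (\<lambda>i. w (\<sigma> (Suc i)) - c (Suc i)) [0..<n]" for w
  define G where "G xs j = (if j \<in> {1..n} then xs ! (inv \<sigma> j - 1) + c (inv \<sigma> j) else 0)" for xs j
  let ?L = "{xs. sorted xs \<and> length xs = n \<and> sum_list xs + M = x}"
  have sum_\<sigma>: "(\<Sum>j\<in>{1..n}. h j) = (\<Sum>i<n. h (\<sigma> (Suc i)))" for h :: "nat \<Rightarrow> nat"
    by (subst sum.permute[OF \<sigma>]) (simp add: sum.shift_bounds_cl_Suc_ivl sum.atLeast1_atMost_eq)
  have M: "M = (\<Sum>i<n. c (Suc i))" unfolding M_def c_def by (simp add: sum.atLeast1_atMost_eq)
  have c1: "c (Suc 0) = 0" using D by (auto simp: c_def)
  have step: "w (\<sigma> (Suc i)) + of_bool (Suc i \<in> D) \<le> w (\<sigma> (Suc (Suc i)))"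
    if "w \<in> chains n D \<sigma> x" "Suc i < n" for w i
    using that by (auto simp: chains_def)
  have ge: "c (Suc i) \<le> w (\<sigma> (Suc i))" if "w \<in> chains n D \<sigma> x" "i < n" for w i
    using that(2)
  proof (induction i)
    case (Suc i)
    then show ?case using step[OF that(1), of i] c_Suc[of "Suc i"] by simp
  qed (simp add: c1)
  have G\<sigma>: "G xs (\<sigma> (Suc i)) = xs ! i + c (Suc i)" if "i < n" for xs i
    using that permutes_in_image[OF \<sigma>, of "Suc i"] by (simp add: G_def permutes_inverses(2)[OF \<sigma>])
  have "bij_betw F (chains n D \<sigma> x) ?L"
  proof (rule bij_betw_byWitness[where f' = G])
    show "\<forall>w\<in>chains n D \<sigma> x. G (F w) = w"
    proof (intro ballI ext)
      fix w j assume w: "w \<in> chains n D \<sigma> x"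
      show "G (F w) j = w j"
      proof (cases "j \<in> {1..n}")
        case True
        then have "inv \<sigma> j \<in> {1..n}" using permutes_in_image[OF permutes_inv[OF \<sigma>]] by blast
        then obtain i where i: "inv \<sigma> j = Suc i" "i < n" by (cases "inv \<sigma> j") auto
        then have "\<sigma> (Suc i) = j" using permutes_inverses(1)[OF \<sigma>, of j] by simp
        then show ?thesis using ge[OF w i(2)] i G\<sigma>[OF i(2), of "F w"] by (simp add: F_def)
      next
        case False
        then have "w j = 0" using w by (simp add: chains_def)
        then show ?thesis using False by (simp only: G_def if_False)
      qed
    qed
    show "\<forall>xs\<in>?L. F (G xs) = xs"
      by (auto simp: F_def G\<sigma> intro!: nth_equalityI)
    show "F ` chains n D \<sigma> x \<subseteq> ?L"
    proof safe
      fix w assume w: "w \<in> chains n D \<sigma> x"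
      show "length (F w) = n" by (simp add: F_def)
      show "sorted (F w)"
        unfolding sorted_iff_nth_Suc
      proof safe
        fix i assume i: "Suc i < length (F w)"
        then have "Suc i < n" by (simp add: F_def)
        then show "F w ! i \<le> F w ! Suc i"
          using step[OF w, of i] ge[OF w, of i] c_Suc[of "Suc i"] by (simp add: F_def)
      qed
      have "sum_list (F w) + M = (\<Sum>i<n. w (\<sigma> (Suc i)) - c (Suc i) + c (Suc i))"
        by (simp add: F_def M interv_sum_list_conv_sum_set_nat sum.distrib lessThan_atLeast0)
      also have "\<dots> = (\<Sum>i<n. w (\<sigma> (Suc i)))" using ge[OF w] by (intro sum.cong) auto
      also have "\<dots> = x" using w sum_\<sigma>[of w] by (simp add: chains_def)
      finally show "sum_list (F w) + M = x" .
    qed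
    show "G ` ?L \<subseteq> chains n D \<sigma> x"
    proof safe
      fix xs :: "nat list" assume xs: "sorted xs" "n = length xs" "x = sum_list xs + M"
      have "(\<Sum>j\<in>{1..n}. G xs j) = x"
        unfolding sum_\<sigma> using xs by (simp add: G\<sigma> M sum.distrib sum_list_sum_nth lessThan_atLeast0)
      moreover have "G xs (\<sigma> i) + of_bool (i \<in> D) \<le> G xs (\<sigma> (i + 1))" if i: "i \<in> {1..<n}" for i
      proof -
        obtain k where k: "i = Suc k" using i by (cases i) auto
        have "xs ! k \<le> xs ! Suc k" using xs k i by (simp add: sorted_iff_nth_Suc)
        then show ?thesis using G\<sigma>[of k xs] G\<sigma>[of "Suc k" xs] c_Suc[of "Suc k"] k i by simp
      qed
      moreover have "G xs j = 0" if "j \<notin> {1..n}" for j using that by (simp only: G_def if_False)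
      ultimately show "G xs \<in> chains (length xs) D \<sigma> (sum_list xs + M)"
        using xs by (simp add: chains_def)
    qed
  qed
  then have "card (chains n D \<sigma> x) = card ?L" by (rule bij_betw_same_card)
  also have "?L = (if M \<le> x then {xs. sorted xs \<and> length xs = n \<and> sum_list xs = x - M} else {})" by auto
  finally show ?thesis by (simp add: sorted_count_def)
qed

text \<open>Chains have the generating function \<open>q^M / (q;q)_n\<close>, so multiplication by
  \<open>(q;q)_n\<close> leaves the single monomial \<open>q^M\<close> of the least chain.\<close>

lemma qpoch_chains:
  assumes "\<sigma> permutes {1..n}" and "D \<subseteq> {1..<n}"
  shows "(\<Sum>d\<le>x. coeff (qpoch n) d * int (card (chains n D \<sigma> (x - d)))) =
    of_bool (x = (\<Sum>i\<in>{1..n}. card {m \<in> D. m < i}))"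
proof -
  define M where "M = (\<Sum>i\<in>{1..n}. card {m \<in> D. m < i})"
  have "(\<Sum>d\<le>x. coeff (qpoch n) d * int (card (chains n D \<sigma> (x - d)))) =
    (\<Sum>d\<le>x. coeff (qpoch n) d * int (if M \<le> x - d then sorted_count n (x - d - M) else 0))"
    unfolding card_chains[OF assms] M_def ..
  also have "\<dots> = of_bool (x = M)"
  proof (cases "M \<le> x")
    case True
    have "(\<Sum>d\<le>x. coeff (qpoch n) d * int (if M \<le> x - d then sorted_count n (x - d - M) else 0)) =
      (\<Sum>d\<le>x - M. coeff (qpoch n) d * int (sorted_count n (x - M - d)))"
      by (rule sum.mono_neutral_cong_right) (use True in \<open>auto simp: add.commute\<close>)
    then show ?thesis unfolding qpoch_convolution using True by auto
  next
    case False
    then have "(\<Sum>d\<le>x. coeff (qpoch n) d * int (if M \<le> x - d then sorted_count n (x - d - M) else 0)) = 0"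
      by (intro sum.neutral) auto
    then show ?thesis using False by simp
  qed
  finally show ?thesis by (simp add: M_def)
qed

section \<open>Induction on the number of layers\<close>

definition colsums :: "nat \<Rightarrow> nat \<Rightarrow> (nat \<Rightarrow> nat list) \<Rightarrow> nat list" where
  "colsums n r S = map (\<lambda>l. \<Sum>j\<in>{1..n}. S j ! l) [0..<r]"

definition sequences :: "nat \<Rightarrow> nat \<Rightarrow> nat list \<Rightarrow> (nat \<Rightarrow> nat list) set" where
  "sequences n r e = {S. (\<forall>j\<in>{1..n}. length (S j) = r) \<and> (\<forall>j. j \<notin> {1..n} \<longrightarrow> S j = []) \<and>
    colsums n r S = e}"

definition ranked_sequences where
  "ranked_sequences n R r \<rho> e = {S \<in> sequences n r e. rank_on n (key R S) = \<rho>}"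

text \<open>\<open>Zfinal\<close> with the last permutation left free: the induction on layers runs
  over all final orders, not only the identity.\<close>

definition Zfold :: "nat \<Rightarrow> nat set \<Rightarrow> (nat \<Rightarrow> nat) list \<Rightarrow> nat \<Rightarrow> nat list" where
  "Zfold n R \<sigma>s = foldl (\<lambda>S \<sigma>. Zstep n R \<sigma> S) (\<lambda>_. []) \<sigma>s"

definition perm_words :: "nat \<Rightarrow> nat set \<Rightarrow> nat \<Rightarrow> nat list \<Rightarrow> (nat \<Rightarrow> nat) list set" where
  "perm_words n R r e = {\<sigma>s. length \<sigma>s = r \<and> (\<forall>\<sigma>\<in>set \<sigma>s. \<sigma> permutes {1..n}) \<and>
    colsums n r (Zfold n R \<sigma>s) = e}"

definition ranked_words where
  "ranked_words n R r \<rho> e = {\<sigma>s \<in> perm_words n R r e. rank_on n (key R (Zfold n R \<sigma>s)) = \<rho>}"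

lemma Zfold_Nil [simp]: "Zfold n R [] = (\<lambda>_. [])"
  by (simp add: Zfold_def)

lemma Zfold_snoc [simp]: "Zfold n R (\<sigma>s @ [\<sigma>]) = Zstep n R \<sigma> (Zfold n R \<sigma>s)"
  by (simp add: Zfold_def)

lemma colsums_Cons: "colsums n (Suc r) (\<lambda>j. w j # S j) = (\<Sum>j\<in>{1..n}. w j) # colsums n r S"
  by (simp add: colsums_def upt_conv_Cons del: upt_Suc flip: map_Suc_upt)

lemma colsums_cong: "(\<And>j. j \<in> {1..n} \<Longrightarrow> S j = S' j) \<Longrightarrow> colsums n r S = colsums n r S'"
  unfolding colsums_def by (intro map_cong sum.cong) auto

lemma rank_key_cong:
  "(\<And>j. j \<in> {1..n} \<Longrightarrow> S j = S' j) \<Longrightarrow> rank_on n (key R S) = rank_on n (key R S')"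
  by (rule rank_on_cong) (simp add: key_def)

text \<open>The new column sum is the exponent that survives in \<open>qpoch_chains\<close>; this is
  where words come to represent least chains.\<close>

lemma colsums_Zstep:
  assumes \<sigma>: "\<sigma> permutes {1..n}"
  shows "colsums n (Suc r) (Zstep n R \<sigma> S) =
    (\<Sum>i\<in>{1..n}. card {m \<in> DesRS n R S \<sigma>. m < i}) # colsums n r S"
  unfolding Zstep_def colsums_Cons
  by (subst sum.permute[OF \<sigma>]) (simp add: o_def permutes_inverses(2)[OF \<sigma>])

lemma finite_sequences: "finite (sequences n r e)"
proof (rule finite_subset)
  let ?B = "{xs. set xs \<subseteq> {..sum_list e} \<and> length xs = r}"
  show "finite {S. \<forall>j. (j \<in> {1..n} \<longrightarrow> S j \<in> ?B) \<and> (j \<notin> {1..n} \<longrightarrow> S j = [])}"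
    by (intro finite_set_of_finite_funs finite_lists_length_eq) auto
  show "sequences n r e \<subseteq> {S. \<forall>j. (j \<in> {1..n} \<longrightarrow> S j \<in> ?B) \<and> (j \<notin> {1..n} \<longrightarrow> S j = [])}"
  proof safe
    fix S j x assume S: "S \<in> sequences n r e" and j: "j \<in> {1..n}" and x: "x \<in> set (S j)"
    obtain l where l: "l < r" "x = S j ! l"
      using S j x by (auto simp: sequences_def in_set_conv_nth)
    have "S j ! l \<le> (\<Sum>j\<in>{1..n}. S j ! l)" using j by (intro member_le_sum) auto
    also have "\<dots> = e ! l" using S l by (auto simp: sequences_def colsums_def)
    also have "\<dots> \<le> sum_list e" using S l by (intro elem_le_sum_list) (auto simp: sequences_def colsums_def)
    finally show "x \<le> sum_list e" by (simp add: l)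
  qed (auto simp: sequences_def)
qed

lemma finite_perm_words: "finite (perm_words n R r e)"
proof (rule finite_subset)
  show "perm_words n R r e \<subseteq> {\<sigma>s. set \<sigma>s \<subseteq> {\<sigma>. \<sigma> permutes {1..n}} \<and> length \<sigma>s = r}"
    by (auto simp: perm_words_def)
  show "finite {\<sigma>s. set \<sigma>s \<subseteq> {\<sigma>. \<sigma> permutes {1..n}} \<and> length \<sigma>s = r}"
    by (intro finite_lists_length_eq finite_permutations) simp
qed

lemma finite_chains: "finite (chains n D \<sigma> x)"
proof (rule finite_subset)
  show "finite {w. \<forall>j. (j \<in> {1..n} \<longrightarrow> w j \<in> {..x}) \<and> (j \<notin> {1..n} \<longrightarrow> w j = 0)}"
    by (intro finite_set_of_finite_funs) auto
  show "chains n D \<sigma> x \<subseteq> {w. \<forall>j. (j \<in> {1..n} \<longrightarrow> w j \<in> {..x}) \<and> (j \<notin> {1..n} \<longrightarrow> w j = 0)}"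
  proof safe
    fix w j assume "w \<in> chains n D \<sigma> x" "j \<in> {1..n}"
    then show "w j \<le> x" using member_le_sum[of j "{1..n}" w] by (auto simp: chains_def)
  qed (auto simp: chains_def)
qed

text \<open>Serves both recursions below, in which a summand depends on a list of sequences or on a
  word only through the order it induces.\<close>

lemma sum_by_rank:
  fixes h :: "_ \<Rightarrow> nat"
  assumes "finite A"
  shows "(\<Sum>S\<in>A. h (rank_on n (key R (F S)))) =
    (\<Sum>\<rho> | \<rho> permutes {1..n}. card {S \<in> A. rank_on n (key R (F S)) = \<rho>} * h \<rho>)"
proof -
  have "(\<Sum>S\<in>A. h (rank_on n (key R (F S)))) = (\<Sum>\<rho> | \<rho> permutes {1..n}.
    (\<Sum>S \<in> {S \<in> A. rank_on n (key R (F S)) = \<rho>}. h (rank_on n (key R (F S)))))"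
    by (intro sum.group[symmetric] assms finite_permutations)
      (use rank_on_permutes[OF inj_on_key] in blast)+
  then show ?thesis by simp
qed

text \<open>Splitting off the first coordinates gives a shorter list \<open>S\<close> and, by
  \<open>rank_key_Cons_iff\<close>, a chain for the descent set of \<open>S\<close>. The number of
  chains depends on \<open>S\<close> only through its rank \<open>\<rho>\<close>.\<close>

lemma card_ranked_sequences_Suc:
  assumes \<sigma>: "\<sigma> permutes {1..n}"
  shows "card (ranked_sequences n R (Suc r) (inv \<sigma>) (x # y)) =
    (\<Sum>\<rho> | \<rho> permutes {1..n}. card (ranked_sequences n R r \<rho> y) * card (chains n (inv_descents n \<rho> \<sigma>) \<sigma> x))"
proof -
  let ?X = "SIGMA S:sequences n r y. chains n (DesRS n R S \<sigma>) \<sigma> x"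
  define F where "F = (\<lambda>(S, w) j. if j \<in> {1..n} then (w j :: nat) # S j else [])"
  define G where "G T = ((\<lambda>j. tl (T j), \<lambda>j. if j \<in> {1..n} then hd (T j) else 0)
    :: (nat \<Rightarrow> nat list) \<times> (nat \<Rightarrow> nat))" for T
  have F_cong: "rank_on n (key R (F (S, w))) = rank_on n (key R (\<lambda>j. w j # S j))"
    "colsums n r (F (S, w)) = colsums n r (\<lambda>j. w j # S j)" for S w r
    by (auto simp: F_def intro: rank_key_cong colsums_cong)
  \<comment> \<open>One equivalence that settles both inclusions of the bijection.\<close>
  have FX: "F (S, w) \<in> ranked_sequences n R (Suc r) (inv \<sigma>) (x # y) \<longleftrightarrow> (S, w) \<in> ?X"
    if "\<forall>j. j \<notin> {1..n} \<longrightarrow> w j = 0 \<and> S j = []" for S w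
  proof -
    have "F (S, w) \<in> ranked_sequences n R (Suc r) (inv \<sigma>) (x # y) \<longleftrightarrow>
      (\<forall>j\<in>{1..n}. length (S j) = r) \<and> (\<Sum>j\<in>{1..n}. w j) = x \<and> colsums n r S = y \<and>
      (\<forall>i\<in>{1..<n}. w (\<sigma> i) + of_bool (i \<in> DesRS n R S \<sigma>) \<le> w (\<sigma> (i + 1)))"
      unfolding ranked_sequences_def sequences_def mem_Collect_eq F_cong colsums_Cons rank_key_Cons_iff[OF \<sigma>]
      by (auto simp: F_def)
    then show ?thesis using that unfolding sequences_def chains_def by blast
  qed
  have "bij_betw F ?X (ranked_sequences n R (Suc r) (inv \<sigma>) (x # y))"
  proof (rule bij_betw_byWitness[where f' = G])
    show "\<forall>a\<in>?X. G (F a) = a"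
      by (auto simp: F_def G_def sequences_def chains_def fun_eq_iff)
    have FG: "F (G T) = T" if "T \<in> ranked_sequences n R (Suc r) (inv \<sigma>) (x # y)" for T
    proof
      fix j
      show "F (G T) j = T j"
      proof (cases "j \<in> {1..n}")
        case True
        then have "length (T j) = Suc r" using that by (auto simp: ranked_sequences_def sequences_def)
        then have "T j \<noteq> []" by auto
        then show ?thesis using True by (simp add: F_def G_def)
      next
        case False
        then have "T j = []" using that by (auto simp: ranked_sequences_def sequences_def)
        then show ?thesis using False by (simp add: F_def G_def split: if_splits)
      qed
    qed
    then show "\<forall>T\<in>ranked_sequences n R (Suc r) (inv \<sigma>) (x # y). F (G T) = T" by blast
    show "F ` ?X \<subseteq> ranked_sequences n R (Suc r) (inv \<sigma>) (x # y)"
    proof (rule image_subsetI)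
      fix a assume a: "a \<in> ?X"
      obtain S w where a_eq: "a = (S, w)" by (cases a)
      have "\<forall>j. j \<notin> {1..n} \<longrightarrow> w j = 0 \<and> S j = []"
        using a unfolding a_eq sequences_def chains_def by blast
      then show "F a \<in> ranked_sequences n R (Suc r) (inv \<sigma>) (x # y)" using FX a a_eq by blast
    qed
    show "G ` ranked_sequences n R (Suc r) (inv \<sigma>) (x # y) \<subseteq> ?X"
    proof (rule image_subsetI)
      fix T assume T: "T \<in> ranked_sequences n R (Suc r) (inv \<sigma>) (x # y)"
      obtain S w where G: "G T = (S, w)" by (cases "G T")
      have "\<forall>j. j \<notin> {1..n} \<longrightarrow> w j = 0 \<and> S j = []"
        using T G unfolding ranked_sequences_def sequences_def G_def by auto
      then show "G T \<in> ?X" using FX FG[OF T] T G by metis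
    qed
  qed
  then have "card (ranked_sequences n R (Suc r) (inv \<sigma>) (x # y)) = card ?X"
    by (simp add: bij_betw_same_card)
  also have "\<dots> = (\<Sum>S\<in>sequences n r y. card (chains n (inv_descents n (rank_on n (key R S)) \<sigma>) \<sigma> x))"
    by (subst card_SigmaI) (auto simp: finite_sequences finite_chains DesRS_eq_inv_descents[OF \<sigma>])
  also have "\<dots> = (\<Sum>\<rho> | \<rho> permutes {1..n}. card (ranked_sequences n R r \<rho> y) * card (chains n (inv_descents n \<rho> \<sigma>) \<sigma> x))"
    unfolding ranked_sequences_def
    by (rule sum_by_rank[OF finite_sequences, of "\<lambda>\<rho>. card (chains n (inv_descents n \<rho> \<sigma>) \<sigma> x)" n R "\<lambda>S. S"])
  finally show ?thesis .
qed

text \<open>The order produced by a word determines its last permutation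
  (\<open>rank_key_Zstep\<close>), so that letter must be \<open>\<sigma>\<close>. The recursion is
  that of \<open>card_ranked_sequences_Suc\<close> with the number of chains replaced by the
  indicator of the least chain.\<close>

lemma card_ranked_words_Suc:
  assumes \<sigma>: "\<sigma> permutes {1..n}"
  shows "card (ranked_words n R (Suc r) (inv \<sigma>) (x # y)) =
    (\<Sum>\<rho> | \<rho> permutes {1..n}. card (ranked_words n R r \<rho> y) *
      of_bool (x = (\<Sum>i\<in>{1..n}. card {m \<in> inv_descents n \<rho> \<sigma>. m < i})))"
proof -
  define M where "M \<rho> = (\<Sum>i\<in>{1..n}. card {m \<in> inv_descents n \<rho> \<sigma>. m < i})" for \<rho>
  define h where "h \<rho> = (of_bool (x = M \<rho>) :: nat)" for \<rho>
  let ?X = "{\<sigma>s \<in> perm_words n R r y. x = M (rank_on n (key R (Zfold n R \<sigma>s)))}"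
  have "ranked_words n R (Suc r) (inv \<sigma>) (x # y) = (\<lambda>\<sigma>s. \<sigma>s @ [\<sigma>]) ` ?X"
  proof (intro equalityI subsetI)
    fix \<tau>s assume t: "\<tau>s \<in> ranked_words n R (Suc r) (inv \<sigma>) (x # y)"
    then have "length \<tau>s = Suc r" by (auto simp: ranked_words_def perm_words_def)
    then obtain \<sigma>s \<tau> where \<tau>s: "\<tau>s = \<sigma>s @ [\<tau>]" by (cases \<tau>s rule: rev_cases) auto
    have \<tau>: "\<tau> permutes {1..n}" using t by (auto simp: \<tau>s ranked_words_def perm_words_def)
    then have "inv \<tau> = inv \<sigma>" using t by (simp add: \<tau>s ranked_words_def rank_key_Zstep)
    then have "\<tau> = \<sigma>" using permutes_inv_inv[OF \<tau>] permutes_inv_inv[OF \<sigma>] by metis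
    then have "\<sigma>s \<in> ?X"
      using t by (auto simp: \<tau>s ranked_words_def perm_words_def colsums_Zstep[OF \<sigma>] M_def
          DesRS_eq_inv_descents[OF \<sigma>])
    then show "\<tau>s \<in> (\<lambda>\<sigma>s. \<sigma>s @ [\<sigma>]) ` ?X" using \<tau>s \<open>\<tau> = \<sigma>\<close> by blast
  next
    fix \<tau>s assume "\<tau>s \<in> (\<lambda>\<sigma>s. \<sigma>s @ [\<sigma>]) ` ?X"
    then show "\<tau>s \<in> ranked_words n R (Suc r) (inv \<sigma>) (x # y)"
      using \<sigma> by (auto simp: ranked_words_def perm_words_def colsums_Zstep[OF \<sigma>] M_def
          DesRS_eq_inv_descents[OF \<sigma>] rank_key_Zstep[OF \<sigma>])
  qed
  then have "card (ranked_words n R (Suc r) (inv \<sigma>) (x # y)) = card ?X"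
    by (simp add: card_image inj_on_def)
  also have "\<dots> = (\<Sum>\<sigma>s\<in>perm_words n R r y. if x = M (rank_on n (key R (Zfold n R \<sigma>s))) then 1 else 0)"
    unfolding card_eq_sum by (rule sum.inter_filter[OF finite_perm_words])
  also have "\<dots> = (\<Sum>\<sigma>s\<in>perm_words n R r y. h (rank_on n (key R (Zfold n R \<sigma>s))))"
    by (intro sum.cong) (auto simp: h_def)
  also have "\<dots> = (\<Sum>\<rho> | \<rho> permutes {1..n}. card (ranked_words n R r \<rho> y) * h \<rho>)"
    unfolding ranked_words_def by (rule sum_by_rank[OF finite_perm_words])
  finally show ?thesis by (simp add: h_def M_def)
qed

section \<open>Convolution over exponent vectors\<close>

lemma le_vecs_Nil: "le_vecs [] = {[]}"
  by (auto simp: le_vecs_def)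

lemma bij_le_vecs_Cons: "bij_betw (\<lambda>(a, d). a # d) ({..x} \<times> le_vecs y) (le_vecs (x # y))"
proof (rule bij_betw_byWitness[where f' = "\<lambda>d. (hd d, tl d)"])
  show "(\<lambda>(a, d). a # d) ` ({..x} \<times> le_vecs y) \<subseteq> le_vecs (x # y)"
    by (auto simp: le_vecs_def nth_Cons split: nat.split)
  show "(\<lambda>d. (hd d, tl d)) ` le_vecs (x # y) \<subseteq> {..x} \<times> le_vecs y"
  proof (rule image_subsetI)
    fix d assume d: "d \<in> le_vecs (x # y)"
    then obtain a d' where ad: "d = a # d'" by (cases d) (auto simp: le_vecs_def)
    have "a \<le> x" using d by (force simp: ad le_vecs_def)
    moreover have "d' ! i \<le> y ! i" if "i < length y" for i
    proof -
      have "\<forall>i<Suc (length y). (a # d') ! i \<le> (x # y) ! i" using d by (simp add: ad le_vecs_def)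
      then show ?thesis using that by (auto dest!: spec[of _ "Suc i"])
    qed
    ultimately show "(hd d, tl d) \<in> {..x} \<times> le_vecs y" using d by (simp add: ad le_vecs_def)
  qed
  show "\<forall>d\<in>le_vecs (x # y). (\<lambda>(a, d). a # d) (hd d, tl d) = d"
    by (auto simp: le_vecs_def intro!: hd_Cons_tl)
qed auto

text \<open>The two recursions differ only in their chain factors, and \<open>qpoch_chains\<close>
  converts one factor into the other. Since the recursions sum over all orders of the shorter lists,
  the induction is over arbitrary \<open>\<rho>\<close>.\<close>

lemma ranked_words_convolution:
  assumes "\<rho> permutes {1..n}"
  shows "int (card (ranked_words n R (length e) \<rho> e)) =
    (\<Sum>d\<in>le_vecs e. (\<Prod>i<length e. coeff (qpoch n) (d ! i)) *
      int (card (ranked_sequences n R (length e) \<rho> (map2 (-) e d))))"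
  using assms
proof (induction e arbitrary: \<rho>)
  case Nil
  have "ranked_words n R 0 \<rho> [] = (if rank_on n (key R (\<lambda>_. [])) = \<rho> then {[]} else {})"
    by (auto simp: ranked_words_def perm_words_def colsums_def)
  moreover have "ranked_sequences n R 0 \<rho> [] = (if rank_on n (key R (\<lambda>_. [])) = \<rho> then {\<lambda>_. []} else {})"
  proof -
    have "sequences n 0 [] = {\<lambda>_. []}"
    proof (intro equalityI subsetI)
      fix S assume S: "S \<in> sequences n 0 []"
      have "S j = []" for j using S by (cases "j \<in> {1..n}") (auto simp: sequences_def)
      then show "S \<in> {\<lambda>_. []}" by auto
    qed (auto simp: sequences_def colsums_def)
    then show ?thesis by (auto simp: ranked_sequences_def)
  qed
  ultimately show ?case by (simp add: le_vecs_Nil)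
next
  case (Cons x y)
  \<comment> \<open>The permutation whose use in the newest layer produces the order
    \<open>\<rho>\<close>; both recursions are stated for \<open>inv \<sigma>\<close>.\<close>
  define \<sigma> where "\<sigma> = inv \<rho>"
  have \<sigma>: "\<sigma> permutes {1..n}" and \<rho>: "\<rho> = inv \<sigma>"
    using permutes_inv[OF Cons.prems] permutes_inv_inv[OF Cons.prems] by (auto simp: \<sigma>_def)
  let ?P = "{\<rho>. \<rho> permutes {1..n}}"
  let ?q = "\<lambda>d. coeff (qpoch n) d"
  define Q where "Q d = (\<Prod>i<length y. ?q (d ! i))" for d
  define W where "W \<rho> d = int (card (chains n (inv_descents n \<rho> \<sigma>) \<sigma> d))" for \<rho> d
  define V where "V \<rho> d = int (card (ranked_sequences n R (length y) \<rho> (map2 (-) y d)))" for \<rho> d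
  have W: "(\<Sum>d\<le>x. ?q d * W \<rho> (x - d)) = of_bool (x = (\<Sum>i\<in>{1..n}. card {m \<in> inv_descents n \<rho> \<sigma>. m < i}))" for \<rho>
    unfolding W_def by (rule qpoch_chains[OF \<sigma>]) (auto simp: inv_descents_def)
  have "(\<Sum>d\<in>le_vecs (x # y). (\<Prod>i<length (x # y). ?q (d ! i)) *
      int (card (ranked_sequences n R (length (x # y)) \<rho> (map2 (-) (x # y) d)))) =
    (\<Sum>(a, d)\<in>{..x} \<times> le_vecs y. ?q a * Q d *
      int (card (ranked_sequences n R (Suc (length y)) (inv \<sigma>) ((x - a) # map2 (-) y d))))"
    by (subst sum.reindex_bij_betw[OF bij_le_vecs_Cons, symmetric])
      (simp add: case_prod_unfold prod.lessThan_Suc_shift Q_def \<rho> del: prod.lessThan_Suc)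
  also have "\<dots> = (\<Sum>(a, d)\<in>{..x} \<times> le_vecs y. \<Sum>\<rho>\<in>?P. (?q a * W \<rho> (x - a)) * (Q d * V \<rho> d))"
    unfolding card_ranked_sequences_Suc[OF \<sigma>]
    by (intro sum.cong) (auto simp: W_def V_def sum_distrib_left mult_ac)
  also have "\<dots> = (\<Sum>\<rho>\<in>?P. \<Sum>(a, d)\<in>{..x} \<times> le_vecs y. (?q a * W \<rho> (x - a)) * (Q d * V \<rho> d))"
    unfolding case_prod_unfold by (rule sum.swap)
  \<comment> \<open>For fixed \<open>\<rho>\<close> the newest coordinate separates from the others:
    the first factor is evaluated by \<open>W\<close>, the second by the induction
    hypothesis.\<close>
  also have "\<dots> = (\<Sum>\<rho>\<in>?P. (\<Sum>a\<le>x. ?q a * W \<rho> (x - a)) * (\<Sum>d\<in>le_vecs y. Q d * V \<rho> d))"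
    by (simp add: sum_product sum.cartesian_product)
  also have "\<dots> = (\<Sum>\<rho>\<in>?P. of_bool (x = (\<Sum>i\<in>{1..n}. card {m \<in> inv_descents n \<rho> \<sigma>. m < i})) *
      int (card (ranked_words n R (length y) \<rho> y)))"
    unfolding W Q_def V_def using Cons.IH by (intro sum.cong) auto
  also have "\<dots> = int (card (ranked_words n R (length (x # y)) \<rho> (x # y)))"
    by (simp add: \<rho> card_ranked_words_Suc[OF \<sigma>] mult.commute)
  finally show ?case by simp
qed

section \<open>Standardization\<close>

lemma finite_cells: "finite (cells lam)"
proof (rule finite_subset)
  show "cells lam \<subseteq> (SIGMA i:{..<length lam}. {..<lam ! i})" by (auto simp: cells_def)
qed auto

lemma card_cells: "card (cells lam) = sum_list lam"
proof -
  have "cells lam = (SIGMA i:{..<length lam}. {..<lam ! i})" by (auto simp: cells_def)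
  then show ?thesis by (simp add: sum_list_sum_nth lessThan_atLeast0)
qed

lemma cells_left: "(i, j') \<in> cells lam \<Longrightarrow> j \<le> j' \<Longrightarrow> (i, j) \<in> cells lam"
  by (auto simp: cells_def)

lemma cells_up:
  assumes "is_partition lam n" "(i', j) \<in> cells lam" "i \<le> i'"
  shows "(i, j) \<in> cells lam"
proof -
  have "lam ! i' \<le> lam ! i" if "i < i'" "i' < length lam"
    using assms(1) that by (simp add: is_partition_def sorted_wrt_iff_nth_less)
  then show ?thesis using assms(2,3) by (cases "i = i'") (force simp: cells_def)+
qed

lemma row_mono:
  fixes S :: "nat \<times> nat \<Rightarrow> 'a::order"
  assumes "\<And>i j. (i, j + 1) \<in> cells lam \<Longrightarrow> S (i, j) \<le> S (i, j + 1)"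
  shows "(i, j') \<in> cells lam \<Longrightarrow> j \<le> j' \<Longrightarrow> S (i, j) \<le> S (i, j')"
proof (induction j')
  case (Suc j')
  have "S (i, j') \<le> S (i, Suc j')" using assms[of i j'] Suc.prems by simp
  moreover have "(i, j') \<in> cells lam" by (rule cells_left[OF Suc.prems(1)]) simp
  ultimately show ?case using Suc by (cases "j = Suc j'") auto
qed simp

lemma col_strict_mono:
  fixes S :: "nat \<times> nat \<Rightarrow> 'a::order"
  assumes part: "is_partition lam n"
    and "\<And>i j. (i + 1, j) \<in> cells lam \<Longrightarrow> S (i, j) < S (i + 1, j)"
  shows "(i', j) \<in> cells lam \<Longrightarrow> i < i' \<Longrightarrow> S (i, j) < S (i', j)"
proof (induction i')
  case (Suc i')
  have "S (i', j) < S (Suc i', j)" using assms(2)[of i' j] Suc.prems by simp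
  moreover have "(i', j) \<in> cells lam" by (rule cells_up[OF part Suc.prems(1)]) simp
  ultimately show ?case using Suc by (cases "i = i'") auto
qed simp

lemma
  assumes "is_partition lam n" "T \<in> SYT lam"
  shows SYT_bij: "bij_betw T (cells lam) {1..n}"
    and SYT_inj: "inj_on T (cells lam)"
    and SYT_range: "c \<in> cells lam \<Longrightarrow> T c \<in> {1..n}"
    and SYT_obtain: "m \<in> {1..n} \<Longrightarrow> \<exists>c\<in>cells lam. T c = m"
    and SYT_outside: "c \<notin> cells lam \<Longrightarrow> T c = 0"
proof -
  show bij: "bij_betw T (cells lam) {1..n}" using assms by (simp add: SYT_def is_partition_def)
  show "inj_on T (cells lam)" using bij by (rule bij_betw_imp_inj_on)
  show "c \<in> cells lam \<Longrightarrow> T c \<in> {1..n}" using bij by (rule bij_betw_apply)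
  show "m \<in> {1..n} \<Longrightarrow> \<exists>c\<in>cells lam. T c = m"
    using bij_betw_imp_surj_on[OF bij] by (metis imageE)
  show "c \<notin> cells lam \<Longrightarrow> T c = 0" using assms(2) unfolding SYT_def by blast
qed

text \<open>Go right and then down, through the corner \<open>(i, j')\<close>, which lies in the
  diagram because \<open>lam\<close> is a partition.\<close>

lemma SYT_less:
  assumes part: "is_partition lam n" and T: "T \<in> SYT lam"
    and c: "(i', j') \<in> cells lam" "i \<le> i'" "j \<le> j'" "(i, j) \<noteq> (i', j')"
  shows "T (i, j) < T (i', j')"
proof -
  have row: "T (i, j) \<le> T (i, j')"
    by (rule row_mono[of lam T]) (use T c cells_up[OF part] in \<open>auto simp: SYT_def less_imp_le\<close>)
  show ?thesis
  proof (cases "i = i'")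
    case True
    then have "T (i, j) \<noteq> T (i', j')"
      using c cells_left[OF c(1,3)] inj_onD[OF SYT_inj[OF part T]] by blast
    then show ?thesis using row True by simp
  next
    case False
    have "T (i, j') < T (i', j')"
      by (rule col_strict_mono[OF part, of T]) (use T c False in \<open>auto simp: SYT_def\<close>)
    then show ?thesis using row by simp
  qed
qed

text \<open>The sequences summed over in Gessel's fundamental quasisymmetric function with descent
  set \<open>R\<close>.\<close>

definition compatible :: "nat \<Rightarrow> nat set \<Rightarrow> (nat \<Rightarrow> 'a::linorder) \<Rightarrow> bool" where
  "compatible n R f \<longleftrightarrow> (\<forall>i\<in>{1..<n}. f i < f (i + 1) \<or> f i = f (i + 1) \<and> i \<notin> R)"

text \<open>Positions \<open>i\<close> and \<open>i + 1\<close> lie in one class of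
  \<open>sim R\<close> exactly when \<open>i\<close> is in \<open>R\<close>; ties are then broken
  from right to left, so only a strict increase of \<open>f\<close> keeps them in order.\<close>

lemma rank_key_id_iff: "rank_on n (key R f) = id \<longleftrightarrow> compatible n R f"
proof -
  have "rank_on n (key R f) = id \<longleftrightarrow> (\<forall>i\<in>{1..<n}. key R f i < key R f (i + 1))"
    using rank_on_eq_inv_iff[OF permutes_id, of n "key R f"] by (simp add: inj_on_key)
  moreover have "key R f i < key R f (i + 1) \<longleftrightarrow> f i < f (i + 1) \<or> f i = f (i + 1) \<and> i \<notin> R"
    if "i \<in> {1..<n}" for i
  proof -
    have "{i..<i + 1} = {i}" by auto
    then show ?thesis
      using key_less_iff[of "i + 1" i R f] that by (auto simp: lex_less_def list_less_def sim_def)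
  qed
  ultimately show ?thesis by (simp add: compatible_def)
qed

lemma compatible_mono:
  assumes "compatible n R f" "1 \<le> a" "b \<le> n"
  shows "a \<le> b \<Longrightarrow> f a \<le> f b"
  using assms(3)
proof (induction b)
  case (Suc b)
  show ?case
  proof (cases "a = Suc b")
    case False
    then have "f a \<le> f b" and b: "b \<in> {1..<n}" using Suc assms(2) by auto
    moreover have "f b \<le> f (Suc b)" using bspec[OF assms(1)[unfolded compatible_def] b] by auto
    ultimately show ?thesis by simp
  qed simp
qed simp

text \<open>Otherwise \<open>c'\<close> would lie weakly above and weakly to the left of
  \<open>c\<close>, where \<open>T\<close> has smaller entries.\<close>

lemma col_less_if_not_des:
  assumes part: "is_partition lam n" and T: "T \<in> SYT lam"
    and c: "c \<in> cells lam" "c' \<in> cells lam" "T c' = Suc (T c)" "T c \<notin> des lam T"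
  shows "snd c < snd c'"
proof (rule ccontr)
  assume "\<not> snd c < snd c'"
  note inj = SYT_inj[OF part T]
  have "T c \<in> {1..<n}" using SYT_range[OF part T c(1)] SYT_range[OF part T c(2)] c(3) by simp
  then have "T c \<in> {1..<sum_list lam}" using part by (simp add: is_partition_def)
  moreover have "row_of lam T (T c) = fst c" "row_of lam T (T c + 1) = fst c'"
    using the_inv_into_f_f[OF inj c(1)] the_inv_into_f_f[OF inj c(2)] c(3) by (auto simp: row_of_def)
  ultimately have "fst c' \<le> fst c" using c(4) by (simp add: des_def)
  moreover have "c' \<noteq> c" using c(3) by auto
  ultimately have "T c' < T c"
    using SYT_less[OF part T, of "fst c" "snd c" "fst c'" "snd c'"] c \<open>\<not> snd c < snd c'\<close>
    by (auto simp: prod_eq_iff)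
  then show False using c(3) by simp
qed

text \<open>Along a run of equal entries \<open>T\<close> has no descents, so the run proceeds strictly to the right.\<close>
lemma standard_order:
  assumes part: "is_partition lam n" and T: "T \<in> SYT lam" and f: "compatible n (des lam T) f"
    and c: "c \<in> cells lam" "c' \<in> cells lam"
  shows "T c < T c' \<longleftrightarrow> (f (T c), snd c) < (f (T c'), snd c')"
proof -
  note range = SYT_range[OF part T] and inj = inj_onD[OF SYT_inj[OF part T]]
  have less: "(f (T c), snd c) < (f (T c'), snd c')"
    if "T c < T c'" "c \<in> cells lam" "c' \<in> cells lam" for c c'
    using that
  proof (induction "T c'" arbitrary: c')
    case (Suc m)
    have T1: "1 \<le> T c" "T c' \<le> n" using range[OF Suc.prems(2)] range[OF Suc.prems(3)] by auto
    then have "m \<in> {1..n}" using Suc.prems(1) Suc.hyps(2) by simp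
    \<comment> \<open>The cell of the entry just before \<open>T c'\<close>: from \<open>d\<close>
      to \<open>c'\<close> a single step is compared, and up to \<open>d\<close> the induction
      hypothesis applies.\<close>
    then obtain d where d: "d \<in> cells lam" "T d = m" using SYT_obtain[OF part T] by blast
    have "m \<in> {1..<n}" using T1 \<open>m \<in> {1..n}\<close> Suc.hyps(2) by simp
    then have "f m < f (m + 1) \<or> f m = f (m + 1) \<and> m \<notin> des lam T"
      using f unfolding compatible_def by blast
    moreover have "snd d < snd c'" if "m \<notin> des lam T"
      using col_less_if_not_des[OF part T d(1) Suc.prems(3)] d(2) Suc.hyps(2) that by simp
    ultimately have step: "(f (T d), snd d) < (f (T c'), snd c')"
      using d(2) Suc.hyps(2) by auto
    show ?case
    proof (cases "T c = m")
      case True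
      then have "c = d" using inj[OF _ Suc.prems(2) d(1)] d(2) by simp
      then show ?thesis using step by simp
    next
      case False
      then have "T c < T d" using Suc.prems(1) Suc.hyps(2) d(2) by simp
      then have "(f (T c), snd c) < (f (T d), snd d)"
        using Suc.hyps(1)[OF d(2)[symmetric] _ Suc.prems(2) d(1)] by simp
      then show ?thesis using step by (rule less_trans)
    qed
  qed simp
  show ?thesis
  proof (cases "T c" "T c'" rule: linorder_cases)
    case equal
    then have "c = c'" using inj c by blast
    then show ?thesis by simp
  next
    case greater
    then have "(f (T c'), snd c') < (f (T c), snd c)" using less c by blast
    then show ?thesis using greater by (meson less_asym)
  qed (use less[OF _ c] in blast)
qed

definition fill_by :: "nat list \<Rightarrow> (nat \<times> nat \<Rightarrow> nat) \<times> (nat \<Rightarrow> nat list) \<Rightarrow> nat \<times> nat \<Rightarrow> nat list" where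
  "fill_by lam p = (\<lambda>c. if c \<in> cells lam then snd p (fst p c) else [])"

text \<open>\<open>bij_fill_by\<close> matches these pairs with the semistandard tableaux, which is
  the expansion of a Schur function into fundamental quasisymmetric functions.\<close>

definition std_pairs :: "nat \<Rightarrow> nat \<Rightarrow> nat list \<Rightarrow> ((nat \<times> nat \<Rightarrow> nat) \<times> (nat \<Rightarrow> nat list)) set" where
  "std_pairs n k lam = (SIGMA T:SYT lam. {f. (\<forall>j\<in>{1..n}. length (f j) = k) \<and>
    (\<forall>j. j \<notin> {1..n} \<longrightarrow> f j = []) \<and> compatible n (des lam T) f})"

text \<open>Recovers \<open>T\<close> from the filled tableau alone: by
  \<open>standard_order\<close>, \<open>T\<close> numbers the cells by content and, among equal
  contents, from left to right. This gives injectivity of \<open>fill_by\<close>.\<close>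

lemma std_pairs_determined:
  assumes part: "is_partition lam n" and p: "(T, f) \<in> std_pairs n k lam"
  shows "c \<in> cells lam \<Longrightarrow> T c = card {d \<in> cells lam.
    (fill_by lam (T, f) d, snd d) \<le> (fill_by lam (T, f) c, snd c)}"
proof -
  assume c: "c \<in> cells lam"
  have T: "T \<in> SYT lam" and f: "compatible n (des lam T) f" using p by (auto simp: std_pairs_def)
  have "T d \<le> T c \<longleftrightarrow> (f (T d), snd d) \<le> (f (T c), snd c)" if "d \<in> cells lam" for d
    unfolding linorder_not_less[symmetric] using standard_order[OF part T f c that] by simp
  then have "{d \<in> cells lam. (fill_by lam (T, f) d, snd d) \<le> (fill_by lam (T, f) c, snd c)} = {d \<in> cells lam. T d \<le> T c}"
    using c by (intro Collect_cong) (auto simp: fill_by_def)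
  moreover have "T ` {d \<in> cells lam. T d \<le> T c} = {1..T c}"
  proof -
    have "T ` {d \<in> cells lam. T d \<le> T c} = {m \<in> T ` cells lam. m \<le> T c}" by blast
    also have "T ` cells lam = {1..n}" by (rule bij_betw_imp_surj_on[OF SYT_bij[OF part T]])
    also have "{m \<in> {1..n}. m \<le> T c} = {1..T c}" using SYT_range[OF part T c] by auto
    finally show ?thesis .
  qed
  moreover have "inj_on T {d \<in> cells lam. T d \<le> T c}"
    by (rule inj_on_subset[OF SYT_inj[OF part T]]) blast
  ultimately show "T c = card {d \<in> cells lam. (fill_by lam (T, f) d, snd d) \<le> (fill_by lam (T, f) c, snd c)}"
    by (metis card_image card_atLeastAtMost diff_Suc_1)
qed

lemma inj_on_fill_by:
  assumes part: "is_partition lam n"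
  shows "inj_on (fill_by lam) (std_pairs n k lam)"
proof (rule inj_onI, clarify)
  fix T f T' f' assume p: "(T, f) \<in> std_pairs n k lam" "(T', f') \<in> std_pairs n k lam"
    and eq: "fill_by lam (T, f) = fill_by lam (T', f')"
  have T: "T \<in> SYT lam" "T' \<in> SYT lam" using p unfolding std_pairs_def by blast+
  have TT: "T = T'"
  proof
    fix c show "T c = T' c"
    proof (cases "c \<in> cells lam")
      case True
      then show ?thesis using std_pairs_determined[OF part p(1)] std_pairs_determined[OF part p(2)] eq by simp
    next
      case False
      then show ?thesis using SYT_outside[OF part T(1) False] SYT_outside[OF part T(2) False] by simp
    qed
  qed
  have "f j = f' j" for j
  proof (cases "j \<in> {1..n}")
    case True
    then obtain c where c: "c \<in> cells lam" "T c = j" using SYT_obtain[OF part T(1)] by blast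
    then show ?thesis using fun_cong[OF eq, of c] TT by (simp add: fill_by_def)
  next
    case False
    then have "f j = []" "f' j = []" using p unfolding std_pairs_def by blast+
    then show ?thesis by simp
  qed
  then show "T = T' \<and> f = f'" using TT by auto
qed

lemma fill_by_in_SSYT:
  assumes part: "is_partition lam n" and p: "(T, f) \<in> std_pairs n k lam"
  shows "fill_by lam (T, f) \<in> SSYT_vec k lam"
proof -
  have T: "T \<in> SYT lam" and f: "compatible n (des lam T) f" using p by (auto simp: std_pairs_def)
  note range = SYT_range[OF part T]
  have len: "length (f (T c)) = k" if "c \<in> cells lam" for c
    using range[OF that] p unfolding std_pairs_def by blast
  have row: "f (T (i, j)) \<le> f (T (i, j + 1))" "(i, j) \<in> cells lam" if "(i, j + 1) \<in> cells lam" for i j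
  proof -
    show ij: "(i, j) \<in> cells lam" using that by (auto simp: cells_def)
    have "T (i, j) < T (i, j + 1)" using that T by (simp add: SYT_def)
    then show "f (T (i, j)) \<le> f (T (i, j + 1))"
      using compatible_mono[OF f] range[OF that] range[OF ij] by simp
  qed
  have col: "f (T (i, j)) < f (T (i + 1, j))" "(i, j) \<in> cells lam" if "(i + 1, j) \<in> cells lam" for i j
  proof -
    show ij: "(i, j) \<in> cells lam" using cells_up[OF part that, of i] by simp
    have "T (i, j) < T (i + 1, j)" using that T by (simp add: SYT_def)
    \<comment> \<open>Both cells lie in column \<open>j\<close>, so the inequality of pairs in
      \<open>standard_order\<close> can only come from a strict increase of
      \<open>f\<close>.\<close>
    then show "f (T (i, j)) < f (T (i + 1, j))" using standard_order[OF part T f ij that] by auto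
  qed
  show ?thesis
    unfolding SSYT_vec_def lex_le_def lex_less_def list_less_def[symmetric]
  proof (intro CollectI conjI ballI allI impI)
    show "length (fill_by lam (T, f) c) = k" if "c \<in> cells lam" for c
      using len[OF that] that by (simp add: fill_by_def)
    show "fill_by lam (T, f) c = []" if "c \<notin> cells lam" for c
      using that by (simp add: fill_by_def)
    show "fill_by lam (T, f) (i, j) = fill_by lam (T, f) (i, j + 1) \<or>
      fill_by lam (T, f) (i, j) < fill_by lam (T, f) (i, j + 1)" if "(i, j + 1) \<in> cells lam" for i j
      using row[OF that] that by (auto simp: fill_by_def order.order_iff_strict)
    show "fill_by lam (T, f) (i, j) < fill_by lam (T, f) (i + 1, j)" if "(i + 1, j) \<in> cells lam" for i j
      using col[OF that] that by (simp add: fill_by_def)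
  qed
qed

text \<open>Standardization of \<open>S\<close>: a column never repeats an entry, so ordering the
  cells by entry and then by column is strict. \<open>T\<close> numbers the cells in this order and
  \<open>f\<close> lists their entries.\<close>

lemma SSYT_in_fill_by:
  assumes part: "is_partition lam n" and S: "S \<in> SSYT_vec k lam"
  shows "S \<in> fill_by lam ` std_pairs n k lam"
proof -
  have n: "sum_list lam = n" using part by (simp add: is_partition_def)
  have len: "length (S c) = k" if "c \<in> cells lam" for c using S that by (simp add: SSYT_vec_def)
  have row1: "S (i, j) \<le> S (i, j + 1)" if "(i, j + 1) \<in> cells lam" for i j
    using S that unfolding SSYT_vec_def lex_le_def lex_less_def list_less_def list_le_def by blast
  have col1: "S (i, j) < S (i + 1, j)" if "(i + 1, j) \<in> cells lam" for i j
    using S that unfolding SSYT_vec_def lex_less_def list_less_def by blast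
  have row: "S (i, j) \<le> S (i, j')" if "(i, j') \<in> cells lam" "j \<le> j'" for i j j'
    by (rule row_mono[OF row1 that])
  have col: "S (i, j) < S (i', j)" if "(i', j) \<in> cells lam" "i < i'" for i i' j
    by (rule col_strict_mono[OF part col1 that])
  define g where "g c = (S c, snd c)" for c
  have inj_g: "inj_on g (cells lam)"
  proof (rule inj_onI)
    fix c c' assume c: "c \<in> cells lam" "c' \<in> cells lam" "g c = g c'"
    then have "snd c = snd c'" "S c = S c'" by (auto simp: g_def)
    then have "fst c = fst c'"
      using c col[of "fst c" "snd c" "fst c'"] col[of "fst c'" "snd c" "fst c"]
      by (metis less_irrefl linorder_neqE_nat prod.collapse)
    then show "c = c'" using \<open>snd c = snd c'\<close> by (simp add: prod_eq_iff)
  qed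
  define T where "T c = (if c \<in> cells lam then card {d \<in> cells lam. g d \<le> g c} else 0)" for c
  have "bij_betw (\<lambda>c. card {d \<in> cells lam. g d \<le> g c}) (cells lam) {1..n}"
    using bij_betw_card_le[OF finite_cells inj_g] by (simp add: card_cells n)
  then have bij: "bij_betw T (cells lam) {1..n}"
    by (rule bij_betw_cong[THEN iffD1, rotated]) (simp add: T_def)
  then have inj: "inj_on T (cells lam)" by (simp add: bij_betw_def)
  have T_less: "T c < T d \<longleftrightarrow> g c < g d" if "c \<in> cells lam" "d \<in> cells lam" for c d
    using card_le_less_iff[OF finite_cells that, of g] that by (simp add: T_def)
  have T: "T \<in> SYT lam"
    unfolding SYT_def
  proof (intro CollectI conjI allI impI)
    show "bij_betw T (cells lam) {1..sum_list lam}" using bij n by simp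
    show "T c = 0" if "c \<notin> cells lam" for c using that by (simp add: T_def)
    show "T (i, j) < T (i, j + 1)" if "(i, j + 1) \<in> cells lam" for i j
    proof -
      have "g (i, j) < g (i, j + 1)" using row1[OF that] by (simp add: g_def le_less)
      then show ?thesis using T_less that cells_left[OF that, of j] by simp
    qed
    show "T (i, j) < T (i + 1, j)" if "(i + 1, j) \<in> cells lam" for i j
    proof -
      have "g (i, j) < g (i + 1, j)" using col1[OF that] by (simp add: g_def)
      then show ?thesis using T_less that cells_up[OF part that, of i] by simp
    qed
  qed
  define pos where "pos = the_inv_into (cells lam) T"
  define f where "f m = (if m \<in> {1..n} then S (pos m) else [])" for m
  have pos: "pos m \<in> cells lam" "T (pos m) = m" if "m \<in> {1..n}" for m
    using that bij_betw_imp_surj_on[OF bij] the_inv_into_into[OF inj, of m "cells lam"] f_the_inv_into_f[OF inj, of m]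
    by (auto simp: pos_def)
  have pos_T: "pos (T c) = c" "T c \<in> {1..n}" if "c \<in> cells lam" for c
    using the_inv_into_f_f[OF inj that] bij_betw_apply[OF bij that] by (auto simp: pos_def)
  have "compatible n (des lam T) f"
    unfolding compatible_def
  proof
    fix m assume m: "m \<in> {1..<n}"
    then have m1: "m \<in> {1..n}" "m + 1 \<in> {1..n}" by auto
    let ?c = "pos m" and ?d = "pos (m + 1)"
    have "g ?c < g ?d" using T_less[of ?c ?d] pos[OF m1(1)] pos[OF m1(2)] by simp
    then have "S ?c < S ?d \<or> S ?c = S ?d \<and> snd ?c < snd ?d" by (auto simp: g_def le_less)
    moreover have "m \<notin> des lam T" if eq: "S ?c = S ?d" and sn: "snd ?c < snd ?d"
    proof
      assume "m \<in> des lam T"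
      then have "fst ?c < fst ?d" by (simp add: des_def row_of_def pos_def)
      have d: "(fst ?d, snd ?d) \<in> cells lam" using pos(1)[OF m1(2)] by simp
      \<comment> \<open>The corner in the column of \<open>?c\<close> and the row of
        \<open>?d\<close>: going down to it raises the entry strictly, and going right from it to
        \<open>?d\<close> never lowers it, so the two entries cannot be equal.\<close>
      have cd: "(fst ?d, snd ?c) \<in> cells lam" by (rule cells_left[OF d]) (use sn in simp)
      have "S (fst ?c, snd ?c) < S (fst ?d, snd ?c)" by (rule col) fact+
      also have "\<dots> \<le> S (fst ?d, snd ?d)" by (rule row[OF d]) (use sn in simp)
      finally show False using eq by simp
    qed
    ultimately show "f m < f (m + 1) \<or> f m = f (m + 1) \<and> m \<notin> des lam T"
      using m1 by (auto simp: f_def)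
  qed
  moreover have "\<forall>j\<in>{1..n}. length (f j) = k" using len pos(1) by (simp add: f_def)
  moreover have "\<forall>j. j \<notin> {1..n} \<longrightarrow> f j = []" by (simp only: f_def if_False) simp
  ultimately have "(T, f) \<in> std_pairs n k lam" using T unfolding std_pairs_def by blast
  moreover have "fill_by lam (T, f) = S"
    using S pos_T by (auto simp: fill_by_def f_def fun_eq_iff SSYT_vec_def)
  ultimately show ?thesis by (metis imageI)
qed

lemma bij_fill_by:
  assumes "is_partition lam n"
  shows "bij_betw (fill_by lam) (std_pairs n k lam) (SSYT_vec k lam)"
  unfolding bij_betw_def
proof (intro conjI equalityI subsetI)
  fix S assume "S \<in> fill_by lam ` std_pairs n k lam"
  then show "S \<in> SSYT_vec k lam" using fill_by_in_SSYT[OF assms] by force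
qed (use inj_on_fill_by[OF assms] SSYT_in_fill_by[OF assms] in blast)+

lemma sum_fill_by:
  assumes part: "is_partition lam n" and T: "T \<in> SYT lam"
  shows "(\<Sum>c\<in>cells lam. fill_by lam (T, f) c ! l) = (\<Sum>j\<in>{1..n}. f j ! l)"
proof -
  have "bij_betw T (cells lam) {1..n}" using T part by (simp add: SYT_def is_partition_def)
  then have "(\<Sum>c\<in>cells lam. f (T c) ! l) = (\<Sum>j\<in>{1..n}. f j ! l)"
    by (rule sum.reindex_bij_betw)
  then show ?thesis by (simp add: fill_by_def)
qed

lemma finite_SYT: "finite (SYT lam)"
proof (rule finite_subset)
  show "SYT lam \<subseteq> {T. \<forall>c. (c \<in> cells lam \<longrightarrow> T c \<in> {1..sum_list lam}) \<and> (c \<notin> cells lam \<longrightarrow> T c = 0)}"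
    unfolding SYT_def bij_betw_def by blast
qed (intro finite_set_of_finite_funs finite_cells finite_atLeastAtMost)

text \<open>Restricts \<open>bij_fill_by\<close> to a given weight, which \<open>sum_fill_by\<close>
  carries over; by \<open>rank_key_id_iff\<close>, inducing the order \<open>id\<close> means
  compatibility with the descents of \<open>T\<close>.\<close>

lemma schur_coeff_eq_sum:
  assumes part: "is_partition lam n" and e: "length e = k"
  shows "schur_coeff k lam e = (\<Sum>T\<in>SYT lam. card (ranked_sequences n (des lam T) k id e))"
proof -
  let ?X = "{S \<in> SSYT_vec k lam. \<forall>l < k. (\<Sum>c\<in>cells lam. S c ! l) = e ! l}"
  have "bij_betw (fill_by lam) (SIGMA T:SYT lam. ranked_sequences n (des lam T) k id e) ?X"
  proof (rule bij_betw_subset[OF bij_fill_by[OF part]])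
    have mem: "f \<in> ranked_sequences n (des lam T) k id e \<longleftrightarrow> (T, f) \<in> std_pairs n k lam \<and>
        (\<forall>l < k. (\<Sum>c\<in>cells lam. fill_by lam (T, f) c ! l) = e ! l)" if "T \<in> SYT lam" for T f
    proof -
      have "colsums n k f = e \<longleftrightarrow> (\<forall>l < k. (\<Sum>c\<in>cells lam. fill_by lam (T, f) c ! l) = e ! l)"
        unfolding sum_fill_by[OF part that] using e by (simp add: colsums_def list_eq_iff_nth_eq)
      then show ?thesis
        unfolding std_pairs_def ranked_sequences_def sequences_def rank_key_id_iff using that by blast
    qed
    show "(SIGMA T:SYT lam. ranked_sequences n (des lam T) k id e) \<subseteq> std_pairs n k lam"
      using mem by blast
    show "fill_by lam ` (SIGMA T:SYT lam. ranked_sequences n (des lam T) k id e) = ?X"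
    proof (intro equalityI subsetI)
      fix S assume "S \<in> fill_by lam ` (SIGMA T:SYT lam. ranked_sequences n (des lam T) k id e)"
      then obtain T f where p: "S = fill_by lam (T, f)" "T \<in> SYT lam"
        "f \<in> ranked_sequences n (des lam T) k id e" by blast
      then show "S \<in> ?X" using mem[of T f] fill_by_in_SSYT[OF part, of T f k] by blast
    next
      fix S assume S: "S \<in> ?X"
      then obtain T f where p: "S = fill_by lam (T, f)" "(T, f) \<in> std_pairs n k lam"
        using SSYT_in_fill_by[OF part, of S k] by (auto simp del: One_nat_def)
      then have "T \<in> SYT lam" unfolding std_pairs_def by blast
      then show "S \<in> fill_by lam ` (SIGMA T:SYT lam. ranked_sequences n (des lam T) k id e)"
        using mem[of T f] p S by blast
    qed
  qed
  then have "schur_coeff k lam e = card (SIGMA T:SYT lam. ranked_sequences n (des lam T) k id e)"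
    by (simp add: schur_coeff_def bij_betw_same_card)
  also have "\<dots> = (\<Sum>T\<in>SYT lam. card (ranked_sequences n (des lam T) k id e))"
    by (rule card_SigmaI[OF finite_SYT]) (simp add: ranked_sequences_def finite_sequences)
  finally show ?thesis .
qed

section \<open>Symmetry of Schur functions\<close>

text \<open>Symmetry is proved over the alphabet \<open>{0..<N}\<close>;
  \<open>schur_coeff_alphabet\<close> later replaces monomials by their positions in lexicographic
  order.\<close>

definition SSYT_below :: "nat \<Rightarrow> nat list \<Rightarrow> (nat \<times> nat \<Rightarrow> nat) set" where
  "SSYT_below N lam = {S. (\<forall>c\<in>cells lam. S c < N) \<and> (\<forall>c. c \<notin> cells lam \<longrightarrow> S c = 0)
    \<and> (\<forall>i j. (i, j + 1) \<in> cells lam \<longrightarrow> S (i, j) \<le> S (i, j + 1))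
    \<and> (\<forall>i j. (i + 1, j) \<in> cells lam \<longrightarrow> S (i, j) < S (i + 1, j))}"

definition weight :: "nat list \<Rightarrow> (nat \<times> nat \<Rightarrow> nat) \<Rightarrow> nat \<Rightarrow> nat" where
  "weight lam S t = card {c \<in> cells lam. S c = t}"

text \<open>For a semistandard \<open>S\<close> and fixed \<open>t\<close>, the row lengths of the
  partition formed by the entries below \<open>t\<close>; as \<open>t\<close> varies, these make up
  the Gelfand-Tsetlin pattern of \<open>S\<close>.\<close>

definition row_count :: "nat list \<Rightarrow> (nat \<times> nat \<Rightarrow> nat) \<Rightarrow> nat \<Rightarrow> nat \<Rightarrow> nat" where
  "row_count lam S t i = card {j. (i, j) \<in> cells lam \<and> S (i, j) < t}"

text \<open>With \<open>A\<close> and \<open>B\<close> the partitions of entries below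
  \<open>t\<close> and below \<open>t + 2\<close>, interlacing confines row \<open>i\<close> of the
  one between them to the interval from \<open>bk_lower A B i\<close> to
  \<open>bk_upper A B i\<close>. The top row has no row above it, hence the case distinction in the
  upper bound.\<close>

definition bk_lower :: "(nat \<Rightarrow> nat) \<Rightarrow> (nat \<Rightarrow> nat) \<Rightarrow> nat \<Rightarrow> nat" where
  "bk_lower A B i = max (A i) (B (Suc i))"

definition bk_upper :: "(nat \<Rightarrow> nat) \<Rightarrow> (nat \<Rightarrow> nat) \<Rightarrow> nat \<Rightarrow> nat" where
  "bk_upper A B i = (case i of 0 \<Rightarrow> B 0 | Suc i' \<Rightarrow> min (B i) (A i'))"

text \<open>The Bender--Knuth involution, in terms of Gelfand--Tsetlin patterns: in each row the end of the
  block of entries \<open>t\<close> is reflected in the interval to which the neighbouring rows confine it.\<close>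
definition bk_boundary :: "nat list \<Rightarrow> nat \<Rightarrow> (nat \<times> nat \<Rightarrow> nat) \<Rightarrow> nat \<Rightarrow> nat" where
  "bk_boundary lam t S i = (let A = row_count lam S t; B = row_count lam S (t + 2) in
    bk_lower A B i + bk_upper A B i - row_count lam S (t + 1) i)"

definition bender_knuth :: "nat list \<Rightarrow> nat \<Rightarrow> (nat \<times> nat \<Rightarrow> nat) \<Rightarrow> nat \<times> nat \<Rightarrow> nat" where
  "bender_knuth lam t S = (\<lambda>(i, j). if (i, j) \<in> cells lam \<and> S (i, j) \<in> {t, t + 1}
    then if j < bk_boundary lam t S i then t else t + 1 else S (i, j))"

lemma less_card_initial_segment:
  fixes P :: "nat \<Rightarrow> bool"
  assumes "finite {j. P j}" and "\<And>j j'. P j' \<Longrightarrow> j \<le> j' \<Longrightarrow> P j"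
  shows "j < card {j. P j} \<longleftrightarrow> P j"
proof
  assume "P j"
  then have "{..j} \<subseteq> {j. P j}" using assms(2) by blast
  then have "card {..j} \<le> card {j. P j}" by (rule card_mono[OF assms(1)])
  then show "j < card {j. P j}" by simp
next
  assume j: "j < card {j. P j}"
  show "P j"
  proof (rule ccontr)
    assume "\<not> P j"
    then have "{j. P j} \<subseteq> {..<j}" using assms(2) by (metis mem_Collect_eq lessThan_iff linorder_not_less subsetI)
    then have "card {j. P j} \<le> card {..<j}" by (rule card_mono[rotated]) simp
    then show False using j by simp
  qed
qed

lemma finite_row: "finite {j. (i, j) \<in> cells lam \<and> P j}"
  by (rule finite_subset[of _ "{..<lam ! i}"]) (auto simp: cells_def)

text \<open>Rows increase weakly, so the entries below \<open>t\<close> fill an initial segment of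
  the row. This turns counts into comparisons of columns.\<close>

lemma row_count_less_iff:
  assumes S: "S \<in> SSYT_below N lam"
  shows "j < row_count lam S t i \<longleftrightarrow> (i, j) \<in> cells lam \<and> S (i, j) < t"
  unfolding row_count_def
proof (rule less_card_initial_segment[OF finite_row])
  fix j j' assume j: "(i, j') \<in> cells lam \<and> S (i, j') < t" "j \<le> j'"
  have "S (i, j) \<le> S (i, j')"
    by (rule row_mono[of lam S]) (use S j in \<open>auto simp: SSYT_below_def\<close>)
  then show "(i, j) \<in> cells lam \<and> S (i, j) < t" using j cells_left[of i j' lam j] by auto
qed

text \<open>The interlacing of consecutive partitions. Across rows it comes from strict columns: an
  entry below \<open>u + 1\<close> has an entry below \<open>u\<close> directly above it.\<close>

lemma row_count_bounds:
  fixes t :: nat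
  assumes part: "is_partition lam n" and S: "S \<in> SSYT_below N lam"
  defines "A \<equiv> row_count lam S t" and "B \<equiv> row_count lam S (t + 2)" and "M \<equiv> row_count lam S (t + 1)"
  shows "bk_lower A B i \<le> M i" "M i \<le> bk_upper A B i"
proof -
  note less = row_count_less_iff[OF S]
  have le: "a \<le> b" if "\<And>j. j < a \<Longrightarrow> j < b" for a b :: nat
    using that[of b] by (meson less_irrefl linorder_not_less)
  have up: "(i, j) \<in> cells lam" "S (i, j) < S (Suc i, j)" if "(Suc i, j) \<in> cells lam" for i j
    using S that cells_up[OF part that, of i] by (auto simp: SSYT_below_def)
  have "A i \<le> M i" "M i \<le> B i" for i
    by (rule le, simp add: less A_def M_def B_def)+
  moreover have "B (Suc i) \<le> M i" for i
    by (rule le) (use up in \<open>force simp: less B_def M_def\<close>)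
  moreover have "M (Suc i) \<le> A i" for i
    by (rule le) (use up in \<open>force simp: less A_def M_def\<close>)
  ultimately show "bk_lower A B i \<le> M i" "M i \<le> bk_upper A B i"
    by (auto simp: bk_lower_def bk_upper_def split: nat.split)
qed

lemma bk_boundary_bounds:
  fixes t :: nat
  assumes part: "is_partition lam n" and S: "S \<in> SSYT_below N lam"
  defines "A \<equiv> row_count lam S t" and "B \<equiv> row_count lam S (t + 2)" and "M \<equiv> row_count lam S (t + 1)"
  shows "bk_lower A B i \<le> bk_boundary lam t S i" "bk_boundary lam t S i \<le> bk_upper A B i"
    and "bk_boundary lam t S i + M i = bk_lower A B i + bk_upper A B i"
  unfolding bk_boundary_def Let_def A_def B_def M_def
  using row_count_bounds[OF part S, where t = t and i = i] by linarith+

text \<open>Only entries \<open>t\<close> and \<open>t + 1\<close> may change, so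
  \<open>t + 1\<close> is the only threshold affected. The bounds on \<open>bk_boundary\<close> keep
  the new boundary between those of the thresholds \<open>t\<close> and
  \<open>t + 2\<close>.\<close>

lemma bender_knuth_less_iff:
  assumes part: "is_partition lam n" and S: "S \<in> SSYT_below N lam" and c: "(i, j) \<in> cells lam"
  shows "u \<noteq> t + 1 \<Longrightarrow> bender_knuth lam t S (i, j) < u \<longleftrightarrow> S (i, j) < u"
    and "bender_knuth lam t S (i, j) < t + 1 \<longleftrightarrow> j < bk_boundary lam t S i"
proof -
  show "bender_knuth lam t S (i, j) < u \<longleftrightarrow> S (i, j) < u" if "u \<noteq> t + 1"
    using that c by (auto simp: bender_knuth_def)
  have "row_count lam S t i \<le> bk_boundary lam t S i" "bk_boundary lam t S i \<le> row_count lam S (t + 2) i"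
    using bk_boundary_bounds[OF part S, where t = t and i = i]
    by (auto simp: bk_lower_def bk_upper_def split: nat.splits)
  then have "S (i, j) < t \<Longrightarrow> j < bk_boundary lam t S i" "j < bk_boundary lam t S i \<Longrightarrow> S (i, j) < t + 2"
    using row_count_less_iff[OF S, of j t i] row_count_less_iff[OF S, of j "t + 2" i] c by auto
  then show "bender_knuth lam t S (i, j) < t + 1 \<longleftrightarrow> j < bk_boundary lam t S i"
    using c by (auto simp: bender_knuth_def)
qed

lemma bender_knuth_in:
  assumes part: "is_partition lam n" and S: "S \<in> SSYT_below N lam" and t: "t + 1 < N"
  shows "bender_knuth lam t S \<in> SSYT_below N lam"
proof -
  let ?K = "bender_knuth lam t S"
  note less = bender_knuth_less_iff[OF part S, where t = t]
  have row: "?K (i, j) \<le> ?K (i, j + 1)" if c: "(i, j + 1) \<in> cells lam" for i j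
  proof -
    have c': "(i, j) \<in> cells lam" by (rule cells_left[OF c]) simp
    have S_le: "S (i, j) \<le> S (i, j + 1)" using S c by (simp add: SSYT_below_def)
    have "?K (i, j) < u" if "?K (i, j + 1) < u" for u
      using that less(1)[OF c, of u] less(1)[OF c', of u] less(2)[OF c] less(2)[OF c'] S_le
      by (cases "u = t + 1") auto
    then show ?thesis by (meson less_irrefl linorder_not_less)
  qed
  have col: "?K (i, j) < ?K (i + 1, j)" if c: "(i + 1, j) \<in> cells lam" for i j
  proof -
    have c': "(i, j) \<in> cells lam" by (rule cells_up[OF part c]) simp
    have S_less: "S (i, j) < S (i + 1, j)" using S c by (simp add: SSYT_below_def)
    show ?thesis
    proof (cases "S (i, j) = t \<and> S (i + 1, j) = t + 1")
      \<comment> \<open>The only delicate case, a \<open>t\<close> directly above a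
        \<open>t + 1\<close>. The bounds for rows \<open>i\<close> and \<open>i + 1\<close> put
        column \<open>j\<close> before the boundary of the upper row and not before that of the
        lower row, so both entries stay.\<close>
      case True
      have "j < row_count lam S (t + 2) (Suc i)" "\<not> j < row_count lam S t i"
        using True c c' row_count_less_iff[OF S, of j] by auto
      then have "j < bk_boundary lam t S i" "\<not> j < bk_boundary lam t S (i + 1)"
        using bk_boundary_bounds(1)[OF part S, where t = t and i = i]
          bk_boundary_bounds(2)[OF part S, where t = t and i = "i + 1"]
        by (auto simp: bk_lower_def bk_upper_def)
      then have "?K (i, j) < t + 1" "\<not> ?K (i + 1, j) < t + 1"
        using less(2)[OF c] less(2)[OF c'] by auto
      then show ?thesis by simp
    next
      case False
      then show ?thesis using S_less c c' by (auto simp: bender_knuth_def)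
    qed
  qed
  show ?thesis
    unfolding SSYT_below_def
  proof (intro CollectI conjI ballI allI impI)
    show "?K c < N" if "c \<in> cells lam" for c
      using S that t by (auto simp: bender_knuth_def SSYT_below_def split: prod.split)
    show "?K c = 0" if "c \<notin> cells lam" for c
      using S that by (auto simp: bender_knuth_def SSYT_below_def split: prod.split)
  qed (use row col in auto)
qed

lemma row_count_bender_knuth:
  assumes part: "is_partition lam n" and S: "S \<in> SSYT_below N lam" and t: "t + 1 < N"
  shows "row_count lam (bender_knuth lam t S) u i =
    (if u = t + 1 then bk_boundary lam t S i else row_count lam S u i)"
proof -
  let ?K = "bender_knuth lam t S"
  have eq: "a = b" if "\<And>j. j < a \<longleftrightarrow> j < b" for a b :: nat
    using that[of a] that[of b] by (metis less_irrefl linorder_neqE_nat)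
  have "j < bk_boundary lam t S i \<Longrightarrow> (i, j) \<in> cells lam" for j
  proof -
    assume j: "j < bk_boundary lam t S i"
    have "bk_boundary lam t S i \<le> row_count lam S (t + 2) i"
      using bk_boundary_bounds(2)[OF part S, where t = t and i = i]
      by (auto simp: bk_upper_def split: nat.splits)
    then show ?thesis using j row_count_less_iff[OF S, of j "t + 2" i] by simp
  qed
  then show ?thesis
    using row_count_less_iff[OF bender_knuth_in[OF part S t]] row_count_less_iff[OF S]
      bender_knuth_less_iff[OF part S, where t = t]
    by (intro eq) (auto split: if_splits)
qed

text \<open>The reflected intervals depend only on the counts for \<open>t\<close> and
  \<open>t + 2\<close>, which do not change, so a second reflection restores the counts for
  \<open>t + 1\<close>. The counts for all thresholds determine the tableau.\<close>

lemma bender_knuth_involution: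
  assumes part: "is_partition lam n" and S: "S \<in> SSYT_below N lam" and t: "t + 1 < N"
  shows "bender_knuth lam t (bender_knuth lam t S) = S"
proof -
  let ?K = "bender_knuth lam t S"
  have K: "?K \<in> SSYT_below N lam" by (rule bender_knuth_in[OF part S t])
  have KK: "bender_knuth lam t ?K \<in> SSYT_below N lam" by (rule bender_knuth_in[OF part K t])
  have rc: "row_count lam ?K t = row_count lam S t" "row_count lam ?K (t + 2) = row_count lam S (t + 2)"
    "row_count lam ?K (t + 1) = bk_boundary lam t S"
    using row_count_bender_knuth[OF part S t] by (auto simp: fun_eq_iff)
  have "bk_boundary lam t ?K i = row_count lam S (t + 1) i" for i
    using bk_boundary_bounds(3)[OF part S, where t = t and i = i] unfolding bk_boundary_def[of lam t ?K] rc Let_def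
    by simp
  then have same: "row_count lam (bender_knuth lam t ?K) u i = row_count lam S u i" for u i
    using row_count_bender_knuth[OF part K t] row_count_bender_knuth[OF part S t] by simp
  show ?thesis
  proof
    fix c :: "nat \<times> nat"
    obtain i j where c: "c = (i, j)" by (cases c)
    show "bender_knuth lam t ?K c = S c"
    proof (cases "c \<in> cells lam")
      case True
      have "bender_knuth lam t ?K c < u \<longleftrightarrow> S c < u" for u
        using row_count_less_iff[OF KK, of j u i] row_count_less_iff[OF S, of j u i] True same c by simp
      then show ?thesis by (metis less_irrefl linorder_neqE_nat)
    next
      case False
      then show ?thesis using KK S by (simp only: SSYT_below_def mem_Collect_eq) metis
    qed
  qed
qed

lemma weight_eq_sum_rows:
  assumes S: "S \<in> SSYT_below N lam"
  shows "weight lam S t + (\<Sum>i<length lam. row_count lam S t i) = (\<Sum>i<length lam. row_count lam S (t + 1) i)"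
proof -
  let ?r = "\<lambda>i. card {j. (i, j) \<in> cells lam \<and> S (i, j) = t}"
  have "{c \<in> cells lam. S c = t} = (SIGMA i:{..<length lam}. {j. (i, j) \<in> cells lam \<and> S (i, j) = t})"
    by (auto simp: cells_def)
  then have "weight lam S t = (\<Sum>i<length lam. ?r i)"
    unfolding weight_def by (simp add: finite_row)
  moreover have "row_count lam S (t + 1) i = ?r i + row_count lam S t i" for i
  proof -
    have "{j. (i, j) \<in> cells lam \<and> S (i, j) < t + 1} =
      {j. (i, j) \<in> cells lam \<and> S (i, j) = t} \<union> {j. (i, j) \<in> cells lam \<and> S (i, j) < t}" by auto
    then show ?thesis unfolding row_count_def by (simp add: card_Un_disjoint finite_row disjoint_iff)
  qed
  ultimately show ?thesis by (simp add: sum.distrib)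
qed

text \<open>The lower bound of row \<open>i\<close> and the upper bound of row \<open>i + 1\<close>
  are the maximum and the minimum of the same pair \<open>A i\<close>, \<open>B (Suc i)\<close>, so
  together they contribute its sum.\<close>

lemma sum_bk_bounds:
  "(\<Sum>i<m. bk_lower A B i + bk_upper A B i) + bk_upper A B m = B 0 + (\<Sum>i<m. A i + B (Suc i))"
proof (induction m)
  case (Suc m)
  have "bk_lower A B m + bk_upper A B (Suc m) = A m + B (Suc m)"
    by (simp add: bk_lower_def bk_upper_def)
  then show ?case using Suc.IH by simp
qed (simp add: bk_upper_def)

text \<open>All interval ends together add up to the totals for \<open>t\<close> and
  \<open>t + 2\<close>. Reflection therefore replaces the total for \<open>t + 1\<close> by its
  mirror image between these two, which exchanges the numbers of entries \<open>t\<close> and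
  \<open>t + 1\<close>.\<close>

lemma weight_bender_knuth:
  assumes part: "is_partition lam n" and S: "S \<in> SSYT_below N lam" and t: "t + 1 < N"
  shows "weight lam (bender_knuth lam t S) (transpose t (t + 1) u) = weight lam S u"
proof -
  let ?K = "bender_knuth lam t S"
  let ?A = "row_count lam S t" and ?B = "row_count lam S (t + 2)" and ?M = "row_count lam S (t + 1)"
  let ?\<Sigma> = "\<lambda>f. \<Sum>i<length lam. f i"
  have K: "?K \<in> SSYT_below N lam" by (rule bender_knuth_in[OF part S t])
  note rc = row_count_bender_knuth[OF part S t]
  \<comment> \<open>The empty row after the last one makes the final term of
    \<open>sum_bk_bounds\<close> vanish.\<close>
  have B: "?B (length lam) = 0" by (auto simp: row_count_def cells_def)
  then have "bk_upper ?A ?B (length lam) = 0" by (auto simp: bk_upper_def split: nat.split)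
  then have "?\<Sigma> (\<lambda>i. bk_lower ?A ?B i + bk_upper ?A ?B i) = ?B 0 + ?\<Sigma> (\<lambda>i. ?A i + ?B (Suc i))"
    using sum_bk_bounds[of ?A ?B "length lam"] by simp
  also have "\<dots> = ?\<Sigma> ?A + (\<Sum>i<Suc (length lam). ?B i)"
    unfolding sum.lessThan_Suc_shift by (simp add: sum.distrib)
  also have "\<dots> = ?\<Sigma> ?A + ?\<Sigma> ?B" using B by simp
  finally have "?\<Sigma> (bk_boundary lam t S) + ?\<Sigma> ?M = ?\<Sigma> ?A + ?\<Sigma> ?B"
    using bk_boundary_bounds(3)[OF part S, where t = t] by (simp add: sum.distrib flip: sum.distrib)
  moreover have "weight lam S t + ?\<Sigma> ?A = ?\<Sigma> ?M" "weight lam S (t + 1) + ?\<Sigma> ?M = ?\<Sigma> ?B"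
    using weight_eq_sum_rows[OF S, of t] weight_eq_sum_rows[OF S, of "t + 1"] by simp_all
  moreover have "weight lam ?K t + ?\<Sigma> ?A = ?\<Sigma> (bk_boundary lam t S)"
    "weight lam ?K (t + 1) + ?\<Sigma> (bk_boundary lam t S) = ?\<Sigma> ?B"
    using weight_eq_sum_rows[OF K, of t] weight_eq_sum_rows[OF K, of "t + 1"] by (simp_all add: rc)
  ultimately have "weight lam ?K t = weight lam S (t + 1)" "weight lam ?K (t + 1) = weight lam S t"
    by linarith+
  moreover have "weight lam ?K u = weight lam S u" if "u \<noteq> t" "u \<noteq> t + 1"
  proof -
    have "{c \<in> cells lam. ?K c = u} = {c \<in> cells lam. S c = u}"
      using that by (auto simp: bender_knuth_def split: if_splits)
    then show ?thesis by (simp add: weight_def)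
  qed
  ultimately show ?thesis by (cases "u = t"; cases "u = t + 1") auto
qed

section \<open>From adjacent transpositions to all permutations of the alphabet\<close>

definition weight_permutable :: "nat \<Rightarrow> nat list \<Rightarrow> (nat \<Rightarrow> nat) \<Rightarrow> bool" where
  "weight_permutable N lam p \<longleftrightarrow> (\<exists>\<phi>. bij_betw \<phi> (SSYT_below N lam) (SSYT_below N lam) \<and>
    (\<forall>S\<in>SSYT_below N lam. \<forall>u. weight lam (\<phi> S) (p u) = weight lam S u))"

lemma weight_permutable_comp:
  assumes "weight_permutable N lam p" "weight_permutable N lam q"
  shows "weight_permutable N lam (p \<circ> q)"
proof -
  obtain \<phi> \<psi> where \<phi>: "bij_betw \<phi> (SSYT_below N lam) (SSYT_below N lam)"
      "\<forall>S\<in>SSYT_below N lam. \<forall>u. weight lam (\<phi> S) (p u) = weight lam S u"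
    and \<psi>: "bij_betw \<psi> (SSYT_below N lam) (SSYT_below N lam)"
      "\<forall>S\<in>SSYT_below N lam. \<forall>u. weight lam (\<psi> S) (q u) = weight lam S u"
    using assms unfolding weight_permutable_def by blast
  have "\<forall>S\<in>SSYT_below N lam. \<forall>u. weight lam ((\<phi> \<circ> \<psi>) S) ((p \<circ> q) u) = weight lam S u"
    using \<phi>(2) \<psi> by (simp add: bij_betw_apply)
  then show ?thesis
    unfolding weight_permutable_def using bij_betw_trans[OF \<psi>(1) \<phi>(1)] by blast
qed

lemma weight_permutable_adjacent:
  assumes part: "is_partition lam n" and t: "Suc t < N"
  shows "weight_permutable N lam (transpose t (Suc t))"
  unfolding weight_permutable_def
proof (intro exI conjI ballI allI)
  show "bij_betw (bender_knuth lam t) (SSYT_below N lam) (SSYT_below N lam)"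
    by (rule bij_betw_byWitness[where f' = "bender_knuth lam t"])
      (use bender_knuth_involution[OF part] bender_knuth_in[OF part] t in auto)
  show "weight lam (bender_knuth lam t S) (transpose t (Suc t) u) = weight lam S u"
    if "S \<in> SSYT_below N lam" for S u
    using weight_bender_knuth[OF part that, of t u] t by simp
qed

lemma weight_permutable_transpose:
  assumes part: "is_partition lam n"
  shows "a < b \<Longrightarrow> b < N \<Longrightarrow> weight_permutable N lam (transpose a b)"
proof (induction b)
  case (Suc b)
  show ?case
  proof (cases "a = b")
    case True
    then show ?thesis using weight_permutable_adjacent[OF part] Suc.prems by simp
  next
    case False
    \<comment> \<open>Conjugating by an adjacent transposition moves the end \<open>b\<close> to
      \<open>Suc b\<close>.\<close>
    have "transpose a (Suc b) = transpose b (Suc b) \<circ> transpose a b \<circ> transpose b (Suc b)"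
      using False Suc.prems by (auto simp: fun_eq_iff transpose_def)
    moreover have "weight_permutable N lam (transpose a b)" using False Suc by simp
    ultimately show ?thesis
      using Suc.prems weight_permutable_adjacent[OF part, of b N] by (simp only: weight_permutable_comp)
  qed
qed simp

lemma weight_permutable:
  assumes part: "is_partition lam n" and "p permutes {..<N}"
  shows "weight_permutable N lam p"
  using assms(2) finite_lessThan
proof (induction rule: permutes_induct)
  case id
  show ?case unfolding weight_permutable_def by (intro exI[of _ "\<lambda>S. S"]) (simp add: bij_betw_def)
next
  case (swap a b p)
  have "weight_permutable N lam (transpose a b)"
    using swap weight_permutable_transpose[OF part, of a b N] weight_permutable_transpose[OF part, of b a N]
    by (cases a b rule: linorder_cases) (auto simp: transpose_commute)
  then show ?case using swap by (intro weight_permutable_comp)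
qed

section \<open>Monomials as a finite alphabet\<close>

lemma sum_weight:
  assumes "S \<in> SSYT_below N lam"
  shows "(\<Sum>c\<in>cells lam. h (S c)) = (\<Sum>u<N. weight lam S u * h u)"
proof -
  have "(\<Sum>c\<in>cells lam. h (S c)) = (\<Sum>u<N. \<Sum>c | c \<in> cells lam \<and> S c = u. h (S c))"
    using assms by (intro sum.group[symmetric] finite_cells) (auto simp: SSYT_below_def)
  then show ?thesis by (simp add: weight_def)
qed

lemma finite_le_vecs: "finite (le_vecs e)"
proof (rule finite_subset)
  show "le_vecs e \<subseteq> {d. set d \<subseteq> {..sum_list e} \<and> length d = length e}"
  proof (safe, goal_cases)
    case (1 d x)
    then obtain i where i: "i < length e" "x = d ! i" by (auto simp: le_vecs_def in_set_conv_nth)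
    then have "x \<le> e ! i" using 1 by (simp add: le_vecs_def)
    also have "\<dots> \<le> sum_list e" using i by (intro elem_le_sum_list)
    finally show ?case by simp
  qed (simp add: le_vecs_def)
qed (intro finite_lists_length_eq, simp)

text \<open>Each coordinate of an entry is one summand of a total \<open>e ! l\<close>, so only the
  finitely many vectors in \<open>le_vecs e\<close> can occur. Replacing them by their positions in
  the lexicographic list \<open>xs\<close> respects the order and so the tableau conditions.\<close>

lemma schur_coeff_alphabet:
  fixes e :: "nat list"
  assumes part: "is_partition lam n" and e: "length e = k"
  defines "xs \<equiv> sorted_list_of_set (le_vecs e)"
  shows "schur_coeff k lam e = card {S \<in> SSYT_below (length xs) lam.
    \<forall>l<k. (\<Sum>u<length xs. weight lam S u * (xs ! u) ! l) = e ! l}"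
proof -
  let ?N = "length xs"
  let ?X = "{S \<in> SSYT_below ?N lam. \<forall>l<k. (\<Sum>u<?N. weight lam S u * (xs ! u) ! l) = e ! l}"
  let ?Y = "{S \<in> SSYT_vec k lam. \<forall>l < k. (\<Sum>c\<in>cells lam. S c ! l) = e ! l}"
  have set_xs: "set xs = le_vecs e" by (simp add: xs_def finite_le_vecs)
  have sorted: "sorted_wrt (<) xs" by (simp add: xs_def)
  have nth_less: "xs ! u < xs ! v \<longleftrightarrow> u < v" if "u < ?N" "v < ?N" for u v
    using sorted_wrt_nth_less[OF sorted, of u v] sorted_wrt_nth_less[OF sorted, of v u] that
    by (cases u v rule: linorder_cases) auto
  have nth_le: "xs ! u \<le> xs ! v \<longleftrightarrow> u \<le> v" if "u < ?N" "v < ?N" for u v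
    using nth_less[OF that(2,1)] by (simp flip: linorder_not_less)
  have len_nth: "length (xs ! u) = k" if "u < ?N" for u
    using nth_mem[OF that] set_xs e by (auto simp: le_vecs_def)
  define F where "F S c = (if c \<in> cells lam then xs ! S c else [])" for S :: "nat \<times> nat \<Rightarrow> nat" and c
  have left: "(i, j) \<in> cells lam" if "(i, j + 1) \<in> cells lam" for i j by (rule cells_left[OF that]) simp
  have up: "(i, j) \<in> cells lam" if "(i + 1, j) \<in> cells lam" for i j by (rule cells_up[OF part that]) simp
  have F_iff: "F S \<in> SSYT_vec k lam \<longleftrightarrow> S \<in> SSYT_below ?N lam"
    if bd: "\<forall>c\<in>cells lam. S c < ?N" and out: "\<forall>c. c \<notin> cells lam \<longrightarrow> S c = 0" for S
  proof -
    have "F S \<in> SSYT_vec k lam \<longleftrightarrow>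
      (\<forall>i j. (i, j + 1) \<in> cells lam \<longrightarrow> F S (i, j) \<le> F S (i, j + 1)) \<and>
      (\<forall>i j. (i + 1, j) \<in> cells lam \<longrightarrow> F S (i, j) < F S (i + 1, j))"
      using bd len_nth unfolding SSYT_vec_def lex_le_def lex_less_def list_less_def[symmetric]
      by (auto simp: F_def order.order_iff_strict)
    also have "(\<forall>i j. (i, j + 1) \<in> cells lam \<longrightarrow> F S (i, j) \<le> F S (i, j + 1)) \<longleftrightarrow>
      (\<forall>i j. (i, j + 1) \<in> cells lam \<longrightarrow> S (i, j) \<le> S (i, j + 1))"
      using bd left nth_le by (auto simp: F_def)
    also have "(\<forall>i j. (i + 1, j) \<in> cells lam \<longrightarrow> F S (i, j) < F S (i + 1, j)) \<longleftrightarrow>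
      (\<forall>i j. (i + 1, j) \<in> cells lam \<longrightarrow> S (i, j) < S (i + 1, j))"
      using bd up nth_less by (auto simp: F_def)
    finally show ?thesis using bd out unfolding SSYT_below_def by blast
  qed
  have sums: "(\<Sum>c\<in>cells lam. F S c ! l) = (\<Sum>u<?N. weight lam S u * (xs ! u) ! l)"
    if "S \<in> SSYT_below ?N lam" for S l
    using sum_weight[OF that, of "\<lambda>u. xs ! u ! l"] by (simp add: F_def)
  have inj: "inj_on F ?X"
  proof (rule inj_onI, rule ext)
    fix S S' c assume S: "S \<in> ?X" "S' \<in> ?X" "F S = F S'"
    show "S c = S' c"
    proof (cases "c \<in> cells lam")
      case True
      then have "S c < ?N" "S' c < ?N" using S(1,2) unfolding SSYT_below_def by blast+
      moreover have "xs ! S c = xs ! S' c" using fun_cong[OF S(3), of c] True by (simp add: F_def)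
      ultimately show ?thesis using nth_eq_iff_index_eq[of xs] sorted by (simp add: xs_def)
    next
      case False
      then have "S c = 0" "S' c = 0" using S unfolding SSYT_below_def by blast+
      then show ?thesis by simp
    qed
  qed
  have "F ` ?X = ?Y"
  proof (intro equalityI subsetI)
    fix S' assume "S' \<in> F ` ?X"
    then obtain S where S: "S' = F S" "S \<in> ?X" by blast
    then have "F S \<in> SSYT_vec k lam" using F_iff[of S] unfolding SSYT_below_def by blast
    then show "S' \<in> ?Y" using S sums[of S] by simp
  next
    fix S' assume S': "S' \<in> ?Y"
    have mem: "S' c \<in> set xs" if c: "c \<in> cells lam" for c
    proof -
      have "S' c ! l \<le> e ! l" if "l < k" for l
      proof -
        have "S' c ! l \<le> (\<Sum>c\<in>cells lam. S' c ! l)" using c by (intro member_le_sum finite_cells) auto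
        then show ?thesis using S' that by simp
      qed
      moreover have "length (S' c) = k" using S' c by (simp add: SSYT_vec_def)
      ultimately show ?thesis unfolding set_xs le_vecs_def using e by simp
    qed
    define S where "S c = (if c \<in> cells lam then (SOME u. u < ?N \<and> xs ! u = S' c) else 0)" for c
    have S: "S c < ?N \<and> xs ! S c = S' c" if "c \<in> cells lam" for c
      unfolding S_def using that someI_ex[of "\<lambda>u. u < ?N \<and> xs ! u = S' c"] mem[OF that]
      by (simp add: in_set_conv_nth)
    have "S' c = []" if "c \<notin> cells lam" for c using S' that unfolding SSYT_vec_def by blast
    then have F: "F S = S'" using S by (auto simp: F_def fun_eq_iff)
    have "S \<in> SSYT_below ?N lam" using F_iff[of S] S S' F by (simp add: S_def)
    then show "S' \<in> F ` ?X" using F S' sums[of S] by (auto intro!: image_eqI[of _ _ S])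
  qed
  then have "card ?Y = card ?X" using card_image[OF inj] by simp
  then show ?thesis by (simp add: schur_coeff_def)
qed

lemma le_vecs_rev: "le_vecs (rev e) = rev ` le_vecs e"
proof -
  have sub: "rev ` le_vecs e \<subseteq> le_vecs (rev e)" for e
    by (auto simp: le_vecs_def rev_nth)
  have "le_vecs (rev e) \<subseteq> rev ` le_vecs e"
  proof
    fix d assume "d \<in> le_vecs (rev e)"
    then have "rev d \<in> le_vecs e" using sub[of "rev e"] by auto
    then show "d \<in> rev ` le_vecs e" by (metis imageI rev_rev_ident)
  qed
  then show ?thesis using sub by blast
qed

text \<open>Reversing the coordinates permutes the alphabet of monomials, without preserving its
  lexicographic order, so this is an instance of the symmetry of Schur functions.\<close>
lemma schur_coeff_rev:
  assumes part: "is_partition lam n" and e: "length e = k"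
  shows "schur_coeff k lam (rev e) = schur_coeff k lam e"
proof -
  define xs where "xs = sorted_list_of_set (le_vecs e)"
  define ys where "ys = sorted_list_of_set (le_vecs (rev e))"
  let ?N = "length xs"
  \<comment> \<open>\<open>ys\<close> lists the reversed vectors in their own lexicographic order.
    Undoing the reversal gives a rearrangement of \<open>xs\<close>, recorded by
    \<open>p\<close>.\<close>
  have "mset (map rev ys) = mset xs"
    by (rule set_eq_iff_mset_eq_distinct[THEN iffD1])
      (auto simp: xs_def ys_def distinct_map finite_le_vecs le_vecs_rev image_image)
  then obtain p where p: "p permutes {..<?N}" "permute_list p xs = map rev ys"
    by (rule mset_eq_permutation)
  have N: "length ys = ?N" using arg_cong[OF p(2), of length] by simp
  have ys: "ys ! u = rev (xs ! p u)" if "u < ?N" for u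
  proof -
    have "map rev ys ! u = xs ! p u" using p that by (metis permute_list_nth)
    then show ?thesis using that N by (metis nth_map rev_rev_ident)
  qed
  have len: "length (xs ! u) = k" if "u < ?N" for u
  proof -
    have "xs ! u \<in> le_vecs e" using nth_mem[OF that] by (simp add: xs_def finite_le_vecs)
    then show ?thesis using e by (simp add: le_vecs_def)
  qed
  have pN: "p u < ?N" if "u < ?N" for u using permutes_in_image[OF p(1), of u] that by simp
  obtain \<phi> where \<phi>: "bij_betw \<phi> (SSYT_below ?N lam) (SSYT_below ?N lam)"
      "\<And>S u. S \<in> SSYT_below ?N lam \<Longrightarrow> weight lam (\<phi> S) (p u) = weight lam S u"
    using weight_permutable[OF part p(1)] unfolding weight_permutable_def by blast
  let ?X = "{S \<in> SSYT_below ?N lam. \<forall>l<k. (\<Sum>u<?N. weight lam S u * (xs ! u) ! l) = e ! l}"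
  let ?Y = "{S \<in> SSYT_below ?N lam. \<forall>l<k. (\<Sum>u<?N. weight lam S u * (ys ! u) ! l) = rev e ! l}"
  have Y_iff: "(\<forall>l<k. (\<Sum>u<?N. weight lam S u * (ys ! u) ! l) = rev e ! l) \<longleftrightarrow>
      (\<forall>l<k. (\<Sum>u<?N. weight lam (\<phi> S) u * (xs ! u) ! l) = e ! l)" (is "?l \<longleftrightarrow> ?r")
    if S: "S \<in> SSYT_below ?N lam" for S
  proof -
    \<comment> \<open>Reversal exchanges the coordinates \<open>l\<close> and
      \<open>k - 1 - l\<close>, while the passage from \<open>S\<close> to \<open>\<phi> S\<close>
      absorbs the rearrangement \<open>p\<close>.\<close>
    have eq: "(\<Sum>u<?N. weight lam S u * (ys ! u) ! (k - 1 - l)) = (\<Sum>u<?N. weight lam (\<phi> S) u * (xs ! u) ! l)"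
      if "l < k" for l
    proof -
      have "(\<Sum>u<?N. weight lam (\<phi> S) u * (xs ! u) ! l) = (\<Sum>u<?N. weight lam (\<phi> S) (p u) * (xs ! p u) ! l)"
        by (subst sum.permute[OF p(1)]) simp
      also have "\<dots> = (\<Sum>u<?N. weight lam S u * (ys ! u) ! (k - 1 - l))"
        using that by (intro sum.cong) (auto simp: \<phi>(2)[OF S] ys rev_nth len pN)
      finally show ?thesis by simp
    qed
    have rev_e: "rev e ! (k - 1 - l) = e ! l" if "l < k" for l using that e by (simp add: rev_nth)
    show ?thesis
    proof
      assume l: ?l
      show ?r
      proof (intro allI impI)
        fix l assume "l < k"
        then show "(\<Sum>u<?N. weight lam (\<phi> S) u * (xs ! u) ! l) = e ! l"
          using l[rule_format, of "k - 1 - l"] eq[of l] rev_e[of l] by simp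
      qed
    next
      assume r: ?r
      show ?l
      proof (intro allI impI)
        fix l assume "l < k"
        then show "(\<Sum>u<?N. weight lam S u * (ys ! u) ! l) = rev e ! l"
          using r[rule_format, of "k - 1 - l"] eq[of "k - 1 - l"] rev_e[of "k - 1 - l"] by simp
      qed
    qed
  qed
  have "bij_betw \<phi> ?Y ?X"
  proof (rule bij_betw_subset[OF \<phi>(1)])
    show "\<phi> ` ?Y = ?X"
    proof (intro equalityI subsetI)
      fix S' assume S': "S' \<in> ?X"
      then have "S' \<in> \<phi> ` SSYT_below ?N lam" unfolding bij_betw_imp_surj_on[OF \<phi>(1)] by simp
      then obtain S where "S \<in> SSYT_below ?N lam" "\<phi> S = S'" by blast
      then show "S' \<in> \<phi> ` ?Y" using Y_iff[of S] S' by (intro image_eqI[of _ _ S]) simp_all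
    next
      fix S' assume "S' \<in> \<phi> ` ?Y"
      then obtain S where S: "S' = \<phi> S" "S \<in> ?Y" by blast
      then have "S' \<in> SSYT_below ?N lam" using bij_betw_apply[OF \<phi>(1), of S] by simp
      then show "S' \<in> ?X" using S Y_iff[of S] by simp
    qed
  qed blast
  then have "card ?Y = card ?X" by (rule bij_betw_same_card)
  moreover have "schur_coeff k lam (rev e) = card ?Y"
    using schur_coeff_alphabet[OF part, of "rev e" k] e N unfolding ys_def[symmetric] by simp
  moreover have "schur_coeff k lam e = card ?X"
    using schur_coeff_alphabet[OF part e] unfolding xs_def[symmetric] .
  ultimately show ?thesis by simp
qed

section \<open>Words of permutations and tableaux\<close>

text \<open>Both factors are symmetric under reversing the variables: the product of the
  q-factorials by reindexing, the Schur function by \<open>schur_coeff_rev\<close>.\<close>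

lemma lhs_coeff_rev:
  assumes part: "is_partition lam n" and e: "length e = k"
  shows "lhs_coeff n k lam (rev e) = lhs_coeff n k lam e"
proof -
  let ?f = "\<lambda>e d. (\<Prod>i<k. coeff (qpoch n) (d ! i)) * int (schur_coeff k lam (map2 (-) e d))"
  have "lhs_coeff n k lam (rev e) = (\<Sum>d\<in>le_vecs e. ?f (rev e) (rev d))"
    unfolding lhs_coeff_def le_vecs_rev by (subst sum.reindex) auto
  also have "\<dots> = (\<Sum>d\<in>le_vecs e. ?f e d)"
  proof (rule sum.cong[OF refl])
    fix d assume "d \<in> le_vecs e"
    then have d: "length d = k" using e by (simp add: le_vecs_def)
    have "(\<Prod>i<k. coeff (qpoch n) (rev d ! i)) = (\<Prod>i<k. coeff (qpoch n) (d ! (k - Suc i)))"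
      using d by (intro prod.cong) (auto simp: rev_nth)
    also have "\<dots> = (\<Prod>i<k. coeff (qpoch n) (d ! i))"
      by (rule prod.nat_diff_reindex)
    finally have "(\<Prod>i<k. coeff (qpoch n) (rev d ! i)) = (\<Prod>i<k. coeff (qpoch n) (d ! i))" .
    moreover have "map2 (-) (rev e) (rev d) = rev (map2 (-) e d)"
      using d e by (simp add: zip_rev rev_map)
    ultimately show "?f (rev e) (rev d) = ?f e d"
      using schur_coeff_rev[OF part, of "map2 (-) e d" k] d e by simp
  qed
  finally show ?thesis by (simp add: lhs_coeff_def)
qed

text \<open>Expands the Schur coefficients by standardization and applies
  \<open>ranked_words_convolution\<close> with the order \<open>id\<close> for each \<open>T\<close>
  separately.\<close>

lemma lhs_coeff_eq_sum_words:
  assumes part: "is_partition lam n" and e: "length e = k"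
  shows "lhs_coeff n k lam e = (\<Sum>T\<in>SYT lam. int (card (ranked_words n (des lam T) k id e)))"
proof -
  have "lhs_coeff n k lam e = (\<Sum>d\<in>le_vecs e. \<Sum>T\<in>SYT lam. (\<Prod>i<k. coeff (qpoch n) (d ! i)) *
      int (card (ranked_sequences n (des lam T) k id (map2 (-) e d))))"
    unfolding lhs_coeff_def
  proof (rule sum.cong[OF refl])
    fix d assume "d \<in> le_vecs e"
    then have "length (map2 (-) e d) = k" using e by (simp add: le_vecs_def)
    then show "(\<Prod>i<k. coeff (qpoch n) (d ! i)) * int (schur_coeff k lam (map2 (-) e d)) =
      (\<Sum>T\<in>SYT lam. (\<Prod>i<k. coeff (qpoch n) (d ! i)) *
        int (card (ranked_sequences n (des lam T) k id (map2 (-) e d))))"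
      by (simp add: schur_coeff_eq_sum[OF part] sum_distrib_left)
  qed
  also have "\<dots> = (\<Sum>T\<in>SYT lam. int (card (ranked_words n (des lam T) k id e)))"
    using ranked_words_convolution[OF permutes_id, of n _ e] e by (subst sum.swap) simp
  finally show ?thesis .
qed

section \<open>From words to the set of tableaux\<close>

lemma length_Zfold: "length (Zfold n R \<sigma>s j) = length \<sigma>s"
  by (induction \<sigma>s rule: rev_induct) (simp_all add: Zstep_def)

text \<open>Each permutation in the word is recovered from the order of the sequences it produces.\<close>
lemma Zfold_inject:
  assumes "length \<sigma>s = length \<tau>s" and "\<forall>\<sigma>\<in>set \<sigma>s \<union> set \<tau>s. \<sigma> permutes {1..n}"
    and "\<And>j. j \<in> {1..n} \<Longrightarrow> Zfold n R \<sigma>s j = Zfold n R \<tau>s j"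
  shows "\<sigma>s = \<tau>s"
  using assms
proof (induction \<sigma>s arbitrary: \<tau>s rule: rev_induct)
  case (snoc \<sigma> \<sigma>s)
  then obtain \<tau>s' \<tau> where \<tau>s: "\<tau>s = \<tau>s' @ [\<tau>]" by (cases \<tau>s rule: rev_cases) auto
  have perm: "\<sigma> permutes {1..n}" "\<tau> permutes {1..n}" using snoc.prems(2) by (auto simp: \<tau>s)
  have eq: "Zstep n R \<sigma> (Zfold n R \<sigma>s) j = Zstep n R \<tau> (Zfold n R \<tau>s') j" if "j \<in> {1..n}" for j
    using snoc.prems(3)[OF that] by (simp add: \<tau>s)
  have "inv \<sigma> = inv \<tau>"
    using rank_key_cong[of n "Zstep n R \<sigma> (Zfold n R \<sigma>s)" "Zstep n R \<tau> (Zfold n R \<tau>s')" R] eq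
    by (simp only: rank_key_Zstep[OF perm(1)] rank_key_Zstep[OF perm(2)])
  then have "\<sigma> = \<tau>" using permutes_inv_inv[OF perm(1)] permutes_inv_inv[OF perm(2)] by metis
  moreover have "\<sigma>s = \<tau>s'"
    by (rule snoc.IH) (use snoc.prems(1,2) eq in \<open>auto simp: \<tau>s Zstep_def\<close>)
  ultimately show ?case by (simp add: \<tau>s)
qed simp

text \<open>\<open>Zfold\<close> has nonempty values outside \<open>{1..n}\<close> too; cutting them
  off meets the convention of \<open>std_pairs\<close>.\<close>

definition word_sequence :: "nat \<Rightarrow> nat set \<Rightarrow> (nat \<Rightarrow> nat) list \<Rightarrow> nat \<Rightarrow> nat list" where
  "word_sequence n R \<sigma>s j = (if j \<in> {1..n} then Zfold n R \<sigma>s j else [])"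

text \<open>The order produced is the inverse of the last permutation, so order \<open>id\<close>
  means a word that ends in \<open>id\<close>, as prescribed by \<open>Zfinal\<close>.\<close>

lemma ranked_words_id_iff:
  assumes "k \<ge> 1"
  shows "\<omega> \<in> ranked_words n R k id e \<longleftrightarrow> (\<exists>\<sigma>s. \<omega> = \<sigma>s @ [id] \<and> length \<sigma>s = k - 1 \<and>
    (\<forall>\<sigma>\<in>set \<sigma>s. \<sigma> permutes {1..n}) \<and> colsums n k (Zfold n R \<omega>) = e)"
proof
  assume \<omega>: "\<omega> \<in> ranked_words n R k id e"
  then have "length \<omega> = k" by (simp add: ranked_words_def perm_words_def)
  then obtain \<sigma>s \<tau> where \<omega>_eq: "\<omega> = \<sigma>s @ [\<tau>]" using assms by (cases \<omega> rule: rev_cases) auto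
  have \<tau>: "\<tau> permutes {1..n}" using \<omega> unfolding ranked_words_def perm_words_def \<omega>_eq by simp
  then have "inv \<tau> = id" using \<omega> by (simp add: \<omega>_eq ranked_words_def rank_key_Zstep)
  then have "\<tau> = id" using permutes_inv_inv[OF \<tau>] by (metis inv_id)
  then show "\<exists>\<sigma>s. \<omega> = \<sigma>s @ [id] \<and> length \<sigma>s = k - 1 \<and>
    (\<forall>\<sigma>\<in>set \<sigma>s. \<sigma> permutes {1..n}) \<and> colsums n k (Zfold n R \<omega>) = e"
    using \<omega> by (auto simp: \<omega>_eq ranked_words_def perm_words_def)
next
  assume "\<exists>\<sigma>s. \<omega> = \<sigma>s @ [id] \<and> length \<sigma>s = k - 1 \<and>
    (\<forall>\<sigma>\<in>set \<sigma>s. \<sigma> permutes {1..n}) \<and> colsums n k (Zfold n R \<omega>) = e"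
  then show "\<omega> \<in> ranked_words n R k id e"
    using assms rank_key_Zstep[OF permutes_id, of n R]
    by (auto simp: ranked_words_def perm_words_def permutes_id)
qed

lemma word_sequence_std_pair:
  assumes "T \<in> SYT lam" and \<omega>: "\<omega> \<in> ranked_words n (des lam T) k id e"
  shows "(T, word_sequence n (des lam T) \<omega>) \<in> std_pairs n k lam"
proof -
  let ?R = "des lam T"
  have "rank_on n (key ?R (word_sequence n ?R \<omega>)) = rank_on n (key ?R (Zfold n ?R \<omega>))"
    by (rule rank_key_cong) (simp add: word_sequence_def)
  then have "compatible n ?R (word_sequence n ?R \<omega>)"
    using \<omega> by (simp add: ranked_words_def flip: rank_key_id_iff)
  moreover have "length \<omega> = k" using \<omega> by (simp add: ranked_words_def perm_words_def)
  ultimately show ?thesis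
    using assms(1) by (simp add: std_pairs_def word_sequence_def length_Zfold)
qed

text \<open>Layers are prepended, while the first variable records the last coordinate, that is, the
  oldest layer; hence the reversal.\<close>

lemma qexp_fill_by:
  assumes "is_partition lam n" "T \<in> SYT lam"
  shows "qexp k lam (fill_by lam (T, word_sequence n R \<omega>)) = rev (colsums n k (Zfold n R \<omega>))"
proof (rule nth_equalityI)
  fix i assume "i < length (qexp k lam (fill_by lam (T, word_sequence n R \<omega>)))"
  then have i: "i < k" by (simp add: qexp_def)
  have "qexp k lam (fill_by lam (T, word_sequence n R \<omega>)) ! i = (\<Sum>j\<in>{1..n}. word_sequence n R \<omega> j ! (k - 1 - i))"
    using i by (simp add: qexp_def sum_fill_by[OF assms])
  also have "\<dots> = (\<Sum>j\<in>{1..n}. Zfold n R \<omega> j ! (k - 1 - i))"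
    by (intro sum.cong) (simp_all add: word_sequence_def)
  also have "\<dots> = rev (colsums n k (Zfold n R \<omega>)) ! i"
    using i by (simp add: colsums_def rev_nth)
  finally show "qexp k lam (fill_by lam (T, word_sequence n R \<omega>)) ! i = rev (colsums n k (Zfold n R \<omega>)) ! i" .
qed (simp add: qexp_def colsums_def)

lemma Ptab_eq_fill_by:
  assumes part: "is_partition lam n" and T: "T \<in> SYT lam"
  shows "Ptab lam T \<sigma>s = fill_by lam (T, word_sequence n (des lam T) (\<sigma>s @ [id]))"
proof
  fix c show "Ptab lam T \<sigma>s c = fill_by lam (T, word_sequence n (des lam T) (\<sigma>s @ [id])) c"
    using part SYT_range[OF part T, of c]
    by (simp add: Ptab_def fill_by_def word_sequence_def Zfinal_def Zfold_def is_partition_def)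
qed

text \<open>Since \<open>Tk\<close> is a set, distinct pairs of a standard tableau and a word must
  give distinct tableaux: \<open>inj_on_fill_by\<close> recovers \<open>T\<close> and the sequences,
  and \<open>Zfold_inject\<close> then recovers the word.\<close>

lemma card_Tk_eq_sum_words:
  assumes part: "is_partition lam n" and k: "k \<ge> 1"
  shows "card {P \<in> Tk k lam. qexp k lam P = e} = (\<Sum>T\<in>SYT lam. card (ranked_words n (des lam T) k id (rev e)))"
proof -
  define \<Phi> where "\<Phi> = (\<lambda>(T, \<omega>). fill_by lam (T, word_sequence n (des lam T) \<omega>))"
  let ?X = "SIGMA T:SYT lam. ranked_words n (des lam T) k id (rev e)"
  have n: "sum_list lam = n" using part by (simp add: is_partition_def)
  have inj: "inj_on \<Phi> ?X"
  proof (rule inj_onI, clarify)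
    fix T \<omega> T' \<omega>' assume T: "T \<in> SYT lam" "T' \<in> SYT lam"
      and \<omega>: "\<omega> \<in> ranked_words n (des lam T) k id (rev e)"
      and \<omega>': "\<omega>' \<in> ranked_words n (des lam T') k id (rev e)"
      and eq: "\<Phi> (T, \<omega>) = \<Phi> (T', \<omega>')"
    have p: "(T, word_sequence n (des lam T) \<omega>) = (T', word_sequence n (des lam T') \<omega>')"
      by (rule inj_onD[OF inj_on_fill_by[OF part, of k]])
        (use eq word_sequence_std_pair[OF T(1) \<omega>] word_sequence_std_pair[OF T(2) \<omega>'] in \<open>simp_all add: \<Phi>_def\<close>)
    then have TT: "T = T'" by simp
    have "Zfold n (des lam T) \<omega> j = Zfold n (des lam T) \<omega>' j" if "j \<in> {1..n}" for j
    proof -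
      have "word_sequence n (des lam T) \<omega> j = word_sequence n (des lam T) \<omega>' j"
        using p unfolding TT prod.inject by metis
      then show ?thesis using that by (simp add: word_sequence_def)
    qed
    moreover have "length \<omega> = length \<omega>'" "\<forall>\<sigma>\<in>set \<omega> \<union> set \<omega>'. \<sigma> permutes {1..n}"
      using \<omega> \<omega>' unfolding ranked_words_def perm_words_def by auto
    ultimately show "T = T' \<and> \<omega> = \<omega>'" using Zfold_inject TT by blast
  qed
  have "\<Phi> ` ?X = {P \<in> Tk k lam. qexp k lam P = e}"
  proof (intro equalityI subsetI)
    fix P assume "P \<in> \<Phi> ` ?X"
    then obtain T \<omega> where T: "T \<in> SYT lam" and \<omega>: "\<omega> \<in> ranked_words n (des lam T) k id (rev e)"
      and P: "P = \<Phi> (T, \<omega>)" by blast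
    obtain \<sigma>s where \<sigma>s: "\<omega> = \<sigma>s @ [id]" "length \<sigma>s = k - 1" "\<forall>\<sigma>\<in>set \<sigma>s. \<sigma> permutes {1..n}"
      "colsums n k (Zfold n (des lam T) \<omega>) = rev e"
      using \<omega> unfolding ranked_words_id_iff[OF k] by blast
    have "P = Ptab lam T \<sigma>s" using Ptab_eq_fill_by[OF part T] by (simp add: P \<Phi>_def \<sigma>s(1))
    then have "P \<in> Tk k lam" unfolding Tk_def n using T \<sigma>s by blast
    moreover have "qexp k lam P = e"
      using qexp_fill_by[OF part T, of k "des lam T" \<omega>] \<sigma>s(4) by (simp add: P \<Phi>_def)
    ultimately show "P \<in> {P \<in> Tk k lam. qexp k lam P = e}" by simp
  next
    fix P assume P: "P \<in> {P \<in> Tk k lam. qexp k lam P = e}"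
    then obtain T \<sigma>s where T: "T \<in> SYT lam" and \<sigma>s: "length \<sigma>s = k - 1" "\<forall>\<sigma>\<in>set \<sigma>s. \<sigma> permutes {1..n}"
      and P_eq: "P = Ptab lam T \<sigma>s" unfolding Tk_def n by blast
    have P_eq': "P = \<Phi> (T, \<sigma>s @ [id])" using Ptab_eq_fill_by[OF part T] by (simp add: P_eq \<Phi>_def)
    then have "qexp k lam P = rev (colsums n k (Zfold n (des lam T) (\<sigma>s @ [id])))"
      using qexp_fill_by[OF part T, of k "des lam T" "\<sigma>s @ [id]"] by (simp add: \<Phi>_def)
    then have "colsums n k (Zfold n (des lam T) (\<sigma>s @ [id])) = rev e"
      using P by (metis (mono_tags, lifting) mem_Collect_eq rev_rev_ident)
    then have "\<sigma>s @ [id] \<in> ranked_words n (des lam T) k id (rev e)"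
      unfolding ranked_words_id_iff[OF k] using \<sigma>s by blast
    then show "P \<in> \<Phi> ` ?X" using P_eq' T by blast
  qed
  then have "card {P \<in> Tk k lam. qexp k lam P = e} = card ?X" using card_image[OF inj] by simp
  also have "\<dots> = (\<Sum>T\<in>SYT lam. card (ranked_words n (des lam T) k id (rev e)))"
    by (rule card_SigmaI[OF finite_SYT]) (simp add: ranked_words_def finite_perm_words)
  finally show ?thesis .
qed

theorem theorem7:
  fixes n k :: nat and lam :: "nat list"
  assumes "n \<ge> 1" and "k \<ge> 1" and "is_partition lam n"
  shows "\<forall>e. length e = k \<longrightarrow>
           lhs_coeff n k lam e = int (card {P \<in> Tk k lam. qexp k lam P = e})"
proof (intro allI impI)
  fix e :: "nat list" assume e: "length e = k"
  \<comment> \<open>This reversal compensates for the one in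
    \<open>card_Tk_eq_sum_words\<close>.\<close>
  have "lhs_coeff n k lam e = lhs_coeff n k lam (rev e)"
    using lhs_coeff_rev[OF assms(3) e] by simp
  also have "\<dots> = int (card {P \<in> Tk k lam. qexp k lam P = e})"
    using lhs_coeff_eq_sum_words[OF assms(3), of "rev e" k] card_Tk_eq_sum_words[OF assms(3,2)] e by simp
  finally show "lhs_coeff n k lam e = int (card {P \<in> Tk k lam. qexp k lam P = e})" .
qed

end
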